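(* Suppose that $P$ is $\mu$-optimally strongly convex for some $\mu>0$. Let $\check{x}_0 \in \mathbb{R}^d$, $m \in \mathbb{N}$, $b \in [n]$, $T \in \mathbb{N}$, $S\in\mathbb{N}$ (with $m,S\ge1$), $\gamma = \gamma_*=\frac12\big(3+\sqrt{9+\frac{8b}{m+1}}\big)$ and $\eta=\frac{1}{(1+\gamma_*(m+1)/b)\bar L}$. Define $$\rho = \frac{4\left\{ \left(1-\frac{1}{\gamma_*}\right)^2 + \frac{4}{\eta(m+1)m\mu}\right\}}{\left( 1 - \frac{1}{\gamma_*}\right)^2(S+2)^2}.$$ If $S$ is sufficiently large such that $\rho \in (0, 1)$, then the output $\check x_T$ of $\mathrm{DASVRDA}^{\mathrm{sc}}(\check x_{0}, \gamma_*, \{ L_i \}_{i=1}^n, m, b, S, T)$ satisfies $$\mathbb{E}[P(\check x_{T}) - P(x_* )] \leq \rho^T [P(\check x_{0}) - P(x_* )].$$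
   Context: Setting. $n,d\ge 1$, $[n]=\{1,\dots,n\}$, $\|\cdot\|$ is the Euclidean norm on $\mathbb{R}^d$. Each $f_i:\mathbb{R}^d\to\mathbb{R}$ ($i\in[n]$) is convex, differentiable and $L_i$-smooth with $L_i>0$, i.e. $\|\nabla f_i(x)-\nabla f_i(y)\|\le L_i\|x-y\|$ for all $x,y$. $F=\frac1n\sum_{i=1}^n f_i$. $R:\mathbb{R}^d\to\mathbb{R}$ is convex (possibly non-differentiable) and relatively simple (its proximal mapping is computable at $O(d)$ cost). $P=F+R$, and $x_*$ is a minimizer of $P$, assumed to exist. A function $f$ is $\mu$-optimally strongly convex if it has a minimizer and $\frac{\mu}{2}\|x-x_*\|^2\le f(x)-f(x_* )$ for all $x\in\mathbb{R}^d$ and all minimizers $x_*$ of $f$. $\bar L=\frac1n\sum_{i=1}^n L_i$, and $Q=\{q_i\}_{i=1}^n$ is the probability distribution on $[n]$ with $q_i=\frac{L_i}{n\bar L}$. $\mathrm{prox}_{f}(y)=\mathrm{argmin}_{x}\{\frac12\|x-y\|^2+f(x)\}$. Procedure One Stage AccSVRDA$(\widetilde y,\widetilde x,\eta,m,b,Q)$: set $x_0=z_0=\widetilde y$, $\bar g_0=0$, $\theta_0=\frac12$. For $k=1,\dots,m$: draw $i_k^1,\dots,i_k^b$ independently from $Q$ (independently of the past), let $I_k$ be this sample of $b$ indices (with multiplicity); $\theta_k=\frac{k+1}{2}$; $y_k=(1-\frac1{\theta_k})x_{k-1}+\frac1{\theta_k}z_{k-1}$; $g_k=\frac1b\sum_{i\in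 I_k}\frac{1}{nq_i}(\nabla f_i(y_k)-\nabla f_i(\widetilde x))+\nabla F(\widetilde x)$; $\bar g_k=(1-\frac1{\theta_k})\bar g_{k-1}+\frac1{\theta_k}g_k$; $z_k=\mathrm{argmin}_{z}\{\langle \bar g_k,z\rangle+R(z)+\frac{1}{2\eta\theta_k\theta_{k-1}}\|z-z_0\|^2\}=\mathrm{prox}_{\eta\theta_k\theta_{k-1}R}(z_0-\eta\theta_k\theta_{k-1}\bar g_k)$; $x_k=(1-\frac1{\theta_k})x_{k-1}+\frac1{\theta_k}z_k$. Output $(x_m,z_m)$. Procedure $\mathrm{DASVRDA}^{\mathrm{ns}}(\widetilde x_0,\widetilde z_0,\gamma,\{L_i\},m,b,S)$ ($\gamma>1$): set $\widetilde x_{-1}=\widetilde z_0$, $\widetilde\theta_0=1-\frac1\gamma$, $\eta=\frac{1}{(1+\gamma(m+1)/b)\bar L}$. For $s=1,\dots,S$: $\widetilde\theta_s=(1-\frac1\gamma)\frac{s+2}{2}$; $\widetilde y_s=\widetilde x_{s-1}+\frac{\widetilde\theta_{s-1}-1}{\widetilde\theta_s}(\widetilde x_{s-1}-\widetilde x_{s-2})+\frac{\widetilde\theta_{s-1}}{\widetilde\theta_s}(\widetilde z_{s-1}-\widetilde x_{s-1})$; $(\widetilde x_s,\widetilde z_s)=$ One Stage AccSVRDA$(\widetilde y_s,\widetilde x_{s-1},\eta,m,b,Q)$ with fresh independent samples. Output $\widetilde x_S$. Procedure $\mathrm{DASVRDA}^{\mathrm{sc}}(\check x_0,\gamma,\{L_i\},m,b,S,T)$: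 for $t=1,\dots,T$ set $\check x_t=\mathrm{DASVRDA}^{\mathrm{ns}}(\check x_{t-1},\check x_{t-1},\gamma,\{L_i\},m,b,S)$ with fresh independent samples. Output $\check x_T$. Expectation is over all random index draws. *)

theory Defs
  imports "HOL-Probability.Probability"
begin

section \<open>Gradients, smoothness and optimal strong convexity\<close>

definition grad :: "('a::real_inner \<Rightarrow> real) \<Rightarrow> 'a \<Rightarrow> 'a" where
  "grad f x = (THE D. GDERIV f x :> D)"

lemma grad_eqI:
  assumes "GDERIV f x :> D"
  shows "grad f x = D"
  unfolding grad_def
proof (rule the_equality)
  fix D' assume "GDERIV f x :> D'"
  then have "(\<lambda>h. inner h D') = (\<lambda>h. inner h D)"
    using assms unfolding gderiv_def by (rule has_derivative_unique)
  then have "inner (D' - D) (D' - D) = 0"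
    by (metis inner_diff_right right_minus_eq)
  then show "D' = D" by simp
qed (fact assms)

lemma GDERIV_grad:
  fixes f :: "'a::euclidean_space \<Rightarrow> real"
  assumes "f differentiable (at x)"
  shows "GDERIV f x :> grad f x"
proof -
  obtain f' where f': "(f has_derivative f') (at x)"
    using assms unfolding differentiable_def by blast
  then interpret bounded_linear f' by (rule has_derivative_bounded_linear)
  define D where "D = (\<Sum>b\<in>Basis. f' b *\<^sub>R b)"
  have "f' h = inner h D" for h
  proof -
    have "f' h = f' (\<Sum>b\<in>Basis. inner h b *\<^sub>R b)" by (simp add: euclidean_representation)
    also have "\<dots> = (\<Sum>b\<in>Basis. inner h b * f' b)" by (simp add: sum scaleR)
    also have "\<dots> = inner h D" by (simp add: D_def inner_sum_right mult.commute)
    finally show ?thesis .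
  qed
  then have "GDERIV f x :> D" using f' unfolding gderiv_def by (metis ext)
  then show ?thesis using grad_eqI by metis
qed

definition smooth_with :: "real \<Rightarrow> ('a::real_inner \<Rightarrow> real) \<Rightarrow> bool" where
  "smooth_with K f \<longleftrightarrow>
     (\<forall>x. f differentiable (at x)) \<and>
     (\<forall>x y. norm (grad f x - grad f y) \<le> K * norm (x - y))"

abbreviation is_minimizer :: "('a \<Rightarrow> real) \<Rightarrow> 'a \<Rightarrow> bool" where
  "is_minimizer f x \<equiv> is_arg_min f (\<lambda>_. True) x"

definition optimally_strongly_convex :: "real \<Rightarrow> ('a::real_normed_vector \<Rightarrow> real) \<Rightarrow> bool" where
  "optimally_strongly_convex \<mu> f \<longleftrightarrow>
     (\<exists>x. is_minimizer f x) \<and>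
     (\<forall>xs. is_minimizer f xs \<longrightarrow> (\<forall>x. \<mu> / 2 * (norm (x - xs))\<^sup>2 \<le> f x - f xs))"


section \<open>Problem data\<close>

definition avg_fun :: "nat \<Rightarrow> (nat \<Rightarrow> 'a \<Rightarrow> real) \<Rightarrow> 'a \<Rightarrow> real" where
  "avg_fun n f x = 1 / real n * (\<Sum>i = 1..n. f i x)"

definition objective :: "nat \<Rightarrow> (nat \<Rightarrow> 'a \<Rightarrow> real) \<Rightarrow> ('a \<Rightarrow> real) \<Rightarrow> 'a \<Rightarrow> real" where
  "objective n f R x = avg_fun n f x + R x"

definition L_bar :: "nat \<Rightarrow> (nat \<Rightarrow> real) \<Rightarrow> real" where
  "L_bar n L = 1 / real n * (\<Sum>i = 1..n. L i)"

definition sampling_pmf :: "nat \<Rightarrow> (nat \<Rightarrow> real) \<Rightarrow> nat pmf" where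
  "sampling_pmf n L = embed_pmf (\<lambda>i. if i \<in> {1..n} then L i / (real n * L_bar n L) else 0)"

lemma pmf_sampling_pmf:
  assumes "n \<ge> 1" and pos: "\<And>i. i \<in> {1..n} \<Longrightarrow> L i > 0"
  shows "pmf (sampling_pmf n L) i = (if i \<in> {1..n} then L i / (real n * L_bar n L) else 0)"
  unfolding sampling_pmf_def
proof (rule pmf_embed_pmf)
  have nL: "real n * L_bar n L = (\<Sum>i = 1..n. L i)"
    using assms(1) by (simp add: L_bar_def)
  have sum_pos: "(\<Sum>i = 1..n. L i) > 0"
    using assms by (intro sum_pos) auto
  let ?q = "\<lambda>i. if i \<in> {1..n} then L i / (real n * L_bar n L) else 0"
  show nonneg: "0 \<le> ?q i" for i
    using pos[of i] sum_pos unfolding nL by auto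
  have "(\<integral>\<^sup>+ i. ennreal (?q i) \<partial>count_space UNIV) = (\<Sum>i\<in>{1..n}. ennreal (?q i))"
    by (rule nn_integral_count_space'[of "{1..n}"]) auto
  also have "\<dots> = ennreal (\<Sum>i\<in>{1..n}. ?q i)"
    using nonneg by (intro sum_ennreal) blast
  also have "(\<Sum>i\<in>{1..n}. ?q i) = 1"
    using sum_pos unfolding nL by (simp flip: sum_divide_distrib)
  finally show "(\<integral>\<^sup>+ i. ennreal (?q i) \<partial>count_space UNIV) = 1" by simp
qed


section \<open>The algorithms as probabilistic programs\<close>

text \<open>
  Each procedure denotes the distribution of its output.  A call to \<open>replicate_pmf b Q\<close> draws a
  list of \<open>b\<close> independent samples from \<open>Q\<close>; calls made at different points of a program are
  independent of each other.
\<close>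

definition \<theta> :: "nat \<Rightarrow> real" where
  "\<theta> k = (real k + 1) / 2"

text \<open>
  The state after \<open>k\<close> inner iterations is \<open>(x\<^sub>k, z\<^sub>k, gbar\<^sub>k)\<close>; the arguments \<open>z0\<close> and \<open>xt\<close>
  are the starting point and the snapshot point.
\<close>

definition one_stage_step ::
    "nat \<Rightarrow> (nat \<Rightarrow> 'a::euclidean_space \<Rightarrow> real) \<Rightarrow> ('a \<Rightarrow> real) \<Rightarrow> 'a \<Rightarrow> 'a \<Rightarrow> real \<Rightarrow> nat
     \<Rightarrow> nat pmf \<Rightarrow> nat \<Rightarrow> nat list \<Rightarrow> 'a \<times> 'a \<times> 'a \<Rightarrow> 'a \<times> 'a \<times> 'a" where
  "one_stage_step n f R z0 xt \<eta> b Q k I = (\<lambda>(x, z, gbar).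
     let y = (1 - 1 / \<theta> k) *\<^sub>R x + (1 / \<theta> k) *\<^sub>R z;
         g = (1 / real b) *\<^sub>R
               (\<Sum>i\<leftarrow>I. (1 / (real n * pmf Q i)) *\<^sub>R (grad (f i) y - grad (f i) xt))
             + grad (avg_fun n f) xt;
         gbar' = (1 - 1 / \<theta> k) *\<^sub>R gbar + (1 / \<theta> k) *\<^sub>R g;
         z' = arg_min (\<lambda>w. inner gbar' w + R w
                         + 1 / (2 * \<eta> * \<theta> k * \<theta> (k - 1)) * (norm (w - z0))\<^sup>2) (\<lambda>_. True);
         x' = (1 - 1 / \<theta> k) *\<^sub>R x + (1 / \<theta> k) *\<^sub>R z'
     in (x', z', gbar'))"

primrec one_stage_iter ::
    "nat \<Rightarrow> (nat \<Rightarrow> 'a::euclidean_space \<Rightarrow> real) \<Rightarrow> ('a \<Rightarrow> real) \<Rightarrow> 'a \<Rightarrow> 'a \<Rightarrow> real \<Rightarrow> nat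
     \<Rightarrow> nat pmf \<Rightarrow> nat \<Rightarrow> ('a \<times> 'a \<times> 'a) pmf" where
  "one_stage_iter n f R yt xt \<eta> b Q 0 = return_pmf (yt, yt, 0)"
| "one_stage_iter n f R yt xt \<eta> b Q (Suc k) = do {
     st \<leftarrow> one_stage_iter n f R yt xt \<eta> b Q k;
     I \<leftarrow> replicate_pmf b Q;
     return_pmf (one_stage_step n f R yt xt \<eta> b Q (Suc k) I st)
   }"

definition one_stage_AccSVRDA ::
    "nat \<Rightarrow> (nat \<Rightarrow> 'a::euclidean_space \<Rightarrow> real) \<Rightarrow> ('a \<Rightarrow> real) \<Rightarrow> 'a \<Rightarrow> 'a \<Rightarrow> real \<Rightarrow> nat
     \<Rightarrow> nat \<Rightarrow> nat pmf \<Rightarrow> ('a \<times> 'a) pmf" where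
  "one_stage_AccSVRDA n f R yt xt \<eta> m b Q =
     map_pmf (\<lambda>(x, z, gbar). (x, z)) (one_stage_iter n f R yt xt \<eta> b Q m)"

definition \<theta>_outer :: "real \<Rightarrow> nat \<Rightarrow> real" where
  "\<theta>_outer \<gamma> s = (1 - 1 / \<gamma>) * ((real s + 2) / 2)"

definition step_size :: "real \<Rightarrow> nat \<Rightarrow> nat \<Rightarrow> real \<Rightarrow> real" where
  "step_size \<gamma> m b Lb = 1 / ((1 + \<gamma> * (real m + 1) / real b) * Lb)"

text \<open>
  The state after \<open>s\<close> outer iterations is \<open>(x\<^sub>s, x\<^bsub>s-1\<^esub>, z\<^sub>s)\<close>, with \<open>x\<^bsub>-1\<^esub> = z\<^sub>0\<close>.
\<close>

primrec DASVRDA_ns_iter ::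
    "nat \<Rightarrow> (nat \<Rightarrow> 'a::euclidean_space \<Rightarrow> real) \<Rightarrow> ('a \<Rightarrow> real) \<Rightarrow> 'a \<Rightarrow> 'a \<Rightarrow> real
     \<Rightarrow> (nat \<Rightarrow> real) \<Rightarrow> nat \<Rightarrow> nat \<Rightarrow> nat \<Rightarrow> ('a \<times> 'a \<times> 'a) pmf" where
  "DASVRDA_ns_iter n f R x0 z0 \<gamma> L m b 0 = return_pmf (x0, z0, z0)"
| "DASVRDA_ns_iter n f R x0 z0 \<gamma> L m b (Suc s) = do {
     (x, xprev, z) \<leftarrow> DASVRDA_ns_iter n f R x0 z0 \<gamma> L m b s;
     let y = x + ((\<theta>_outer \<gamma> s - 1) / \<theta>_outer \<gamma> (Suc s)) *\<^sub>R (x - xprev)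
               + (\<theta>_outer \<gamma> s / \<theta>_outer \<gamma> (Suc s)) *\<^sub>R (z - x);
     (x', z') \<leftarrow> one_stage_AccSVRDA n f R y x (step_size \<gamma> m b (L_bar n L)) m b (sampling_pmf n L);
     return_pmf (x', x, z')
   }"

definition DASVRDA_ns ::
    "nat \<Rightarrow> (nat \<Rightarrow> 'a::euclidean_space \<Rightarrow> real) \<Rightarrow> ('a \<Rightarrow> real) \<Rightarrow> 'a \<Rightarrow> 'a \<Rightarrow> real
     \<Rightarrow> (nat \<Rightarrow> real) \<Rightarrow> nat \<Rightarrow> nat \<Rightarrow> nat \<Rightarrow> 'a pmf" where
  "DASVRDA_ns n f R x0 z0 \<gamma> L m b S =
     map_pmf (\<lambda>(x, xprev, z). x) (DASVRDA_ns_iter n f R x0 z0 \<gamma> L m b S)"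

primrec DASVRDA_sc ::
    "nat \<Rightarrow> (nat \<Rightarrow> 'a::euclidean_space \<Rightarrow> real) \<Rightarrow> ('a \<Rightarrow> real) \<Rightarrow> 'a \<Rightarrow> real
     \<Rightarrow> (nat \<Rightarrow> real) \<Rightarrow> nat \<Rightarrow> nat \<Rightarrow> nat \<Rightarrow> nat \<Rightarrow> 'a pmf" where
  "DASVRDA_sc n f R x0 \<gamma> L m b S 0 = return_pmf x0"
| "DASVRDA_sc n f R x0 \<gamma> L m b S (Suc t) = do {
     x \<leftarrow> DASVRDA_sc n f R x0 \<gamma> L m b S t;
     DASVRDA_ns n f R x x \<gamma> L m b S
   }"

end

theory Submission
  imports Defs
begin

text \<open>
  The proof consists of two nested Lyapunov arguments and a restart.  Write \<open>V x = P x - P xs\<close>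
  for the suboptimality and \<open>D x y\<close> for the Bregman distance of \<open>F\<close>, the gap at \<open>x\<close> between \<open>F\<close>
  and its linearization at \<open>y\<close>.

  \<^emph>\<open>Inner stage.\<close>  The recursion for \<open>gbar\<close> is dual averaging in disguise.  With
  \<open>A\<^sub>k = k (k + 1) / 4\<close> the point \<open>z\<^sub>k\<close> minimizes
  \<open>A\<^sub>k (\<langle>gbar\<^sub>k, w\<rangle> + R w) + \<parallel>w - yt\<parallel>\<^sup>2 / (2 \<eta>)\<close>, and each step adds
  \<open>((k + 1) / 2) (\<langle>g, w\<rangle> + R w)\<close> to this model.  The stage is compared with the point
  \<open>u = (1 - \<alpha>) xt + \<alpha> xs\<close> between the snapshot and the minimizer.  The potential, \<open>A\<^sub>k P x\<^sub>k\<close> minus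
  the model gap between \<open>z\<^sub>k\<close> and \<open>u\<close>, grows in expectation by at most a constant multiple of the
  weight of the step (\<open>expected_potential_step\<close>).  What could spoil this is the variance of the
  gradient estimate, and the point of the analysis is how that variance is paid for.  Linearizing
  \<open>F\<close> at the extrapolated point \<open>y\<close> leaves the slack \<open>(1 - \<alpha>) D xt y + \<alpha> D xs y\<close>.
  By co-coercivity the variance is controlled by \<open>D xt y\<close>; going through the gradients at the
  minimizer it is also controlled by \<open>2 (D xs y + D xt xs)\<close>.  Using the two bounds in the
  proportions \<open>1 - \<alpha>\<close> and \<open>\<alpha>\<close> matches the slack term by term, and only a multiple of \<open>D xt xs\<close>,
  which is at most \<open>V xt\<close>, is left over.  Hence (\<open>inner_stage_bound\<close>), with
  \<open>C = 2 / (\<eta> m (m + 1))\<close>,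
  \<open>E [V x\<^sub>m + C \<parallel>z\<^sub>m - u\<parallel>\<^sup>2] \<le> (1 - \<alpha> (1 - 1 / \<gamma>)) V xt + C \<parallel>yt - u\<parallel>\<^sup>2\<close>.

  \<^emph>\<open>Outer loop.\<close>  Take \<open>\<alpha>\<close> to be the reciprocal of the outer weight and multiply by the square of
  that weight.  The extrapolation step is designed so that the distance terms of consecutive stages
  agree, and the weights so that the coefficients of \<open>V\<close> do not increase.  So
  \<open>outer_potential\<close> decreases in expectation (\<open>outer_step\<close>); this needs \<open>\<alpha> \<le> 1\<close>, which holds since
  \<open>\<gamma> \<ge> 3\<close>.

  \<^emph>\<open>Restart.\<close>  Optimal strong convexity turns the initial distance into a multiple of the initial
  suboptimality, so one run of the outer loop contracts \<open>V\<close> by \<open>\<rho>\<close> in expectation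
  (\<open>expectation_ns_le\<close>), and \<open>T\<close> restarts contract it by \<open>\<rho> ^ T\<close>.

  All distributions involved have finite support, so every function is integrable.
\<close>

section \<open>Two elementary facts\<close>

text \<open>
  Extracts first-order conditions: a convexity or optimality inequality along a segment, divided by
  the step length \<open>t\<close>, has this shape.
\<close>

lemma nonneg_of_affine_nonneg:
  fixes X Y :: real
  assumes "\<And>t. 0 < t \<Longrightarrow> t < 1 \<Longrightarrow> 0 \<le> X + t * Y"
  shows "0 \<le> X"
proof (rule tendsto_le)
  have "((\<lambda>t. X + t * Y) \<longlongrightarrow> X + 0 * Y) (at_right 0)"
    by (intro tendsto_intros)
  then show "((\<lambda>t. X + t * Y) \<longlongrightarrow> X) (at_right 0)" by simp
  show "((\<lambda>t. 0) \<longlongrightarrow> 0) (at_right (0::real))" by simp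
  show "\<forall>\<^sub>F t in at_right 0. 0 \<le> X + t * Y"
    using assms by (auto simp: eventually_at_right[of 0 1] intro!: exI[of _ 1])
qed simp

lemma norm_sq_combination:
  fixes p q :: "'a::real_inner"
  shows "(norm ((1 - t) *\<^sub>R p + t *\<^sub>R q))\<^sup>2
     = (1 - t) * (norm p)\<^sup>2 + t * (norm q)\<^sup>2 - t * (1 - t) * (norm (p - q))\<^sup>2"
  unfolding power2_norm_eq_inner
  by (simp add: inner_simps inner_commute algebra_simps)

section \<open>Bregman distances of smooth convex functions\<close>

definition bregman :: "('a::real_inner \<Rightarrow> real) \<Rightarrow> 'a \<Rightarrow> 'a \<Rightarrow> real" where
  "bregman f x y = f x - f y - inner (grad f y) (x - y)"

lemma DERIV_along_line:
  fixes f :: "'a::euclidean_space \<Rightarrow> real"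
  assumes "f differentiable (at (y + t *\<^sub>R h))"
  shows "((\<lambda>t. f (y + t *\<^sub>R h)) has_real_derivative inner (grad f (y + t *\<^sub>R h)) h) (at t)"
proof -
  have "(f has_derivative (\<lambda>h'. inner h' (grad f (y + t *\<^sub>R h)))) (at (y + t *\<^sub>R h))"
    using GDERIV_grad[OF assms] by (simp add: gderiv_def)
  moreover have "((\<lambda>t. y + t *\<^sub>R h) has_derivative (\<lambda>s. s *\<^sub>R h)) (at t)"
    by (auto intro!: derivative_eq_intros)
  ultimately have "((\<lambda>t. f (y + t *\<^sub>R h)) has_derivative
      (\<lambda>s. inner (s *\<^sub>R h) (grad f (y + t *\<^sub>R h)))) (at t)"
    by (rule has_derivative_compose[rotated])
  then show ?thesis
    by (simp add: has_field_derivative_def inner_commute mult.commute[of _ "inner _ _"])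
qed

text \<open>
  A convex function lies above its tangents; this is the one-dimensional fact along the segment
  from \<open>y\<close> to \<open>x\<close>.
\<close>

lemma bregman_nonneg:
  fixes f :: "'a::euclidean_space \<Rightarrow> real"
  assumes "convex_on UNIV f" and "f differentiable (at y)"
  shows "0 \<le> bregman f x y"
proof -
  let ?\<phi> = "\<lambda>t. f (y + t *\<^sub>R (x - y))"
  have "convex_on UNIV ?\<phi>"
  proof (rule convex_onI)
    fix t r s :: real assume "0 < t" "t < 1"
    then have "f ((1 - t) *\<^sub>R (y + r *\<^sub>R (x - y)) + t *\<^sub>R (y + s *\<^sub>R (x - y)))
        \<le> (1 - t) * ?\<phi> r + t * ?\<phi> s"
      by (intro convex_onD[OF assms(1)]) auto
    then show "?\<phi> ((1 - t) *\<^sub>R r + t *\<^sub>R s) \<le> (1 - t) * ?\<phi> r + t * ?\<phi> s"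
      by (simp add: algebra_simps)
  qed simp
  then have "inner (grad f y) (x - y) * (1 - 0) \<le> ?\<phi> 1 - ?\<phi> 0"
    using DERIV_along_line[of f y 0 "x - y"] assms(2)
    by (intro convex_on_imp_above_tangent) auto
  then show ?thesis by (simp add: bregman_def)
qed

text \<open>
  The descent lemma: along the segment from \<open>y\<close> to \<open>x\<close>, the gap between the two sides is monotone
  because the Lipschitz bound on the gradient makes its derivative nonpositive.
\<close>

lemma bregman_le_smooth:
  fixes f :: "'a::euclidean_space \<Rightarrow> real"
  assumes "smooth_with K f"
  shows "bregman f x y \<le> K / 2 * (norm (x - y))\<^sup>2"
proof -
  define h where "h = x - y"
  let ?\<phi> = "\<lambda>t. f (y + t *\<^sub>R h) - t * inner (grad f y) h - K / 2 * t\<^sup>2 * (norm h)\<^sup>2"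
  have "?\<phi> 1 \<le> ?\<phi> 0"
  proof (rule DERIV_nonpos_imp_nonincreasing[of 0 1 ?\<phi>])
    fix t :: real assume t: "0 \<le> t"
    have "(?\<phi> has_real_derivative
        inner (grad f (y + t *\<^sub>R h)) h - inner (grad f y) h - K * t * (norm h)\<^sup>2) (at t)"
      using assms unfolding smooth_with_def
      by (auto intro!: derivative_eq_intros DERIV_along_line)
    moreover have "inner (grad f (y + t *\<^sub>R h) - grad f y) h \<le> (K * norm (t *\<^sub>R h)) * norm h"
    proof -
      have "norm (grad f (y + t *\<^sub>R h) - grad f y) \<le> K * norm ((y + t *\<^sub>R h) - y)"
        using assms unfolding smooth_with_def by blast
      then show ?thesis
        by (intro order_trans[OF norm_cauchy_schwarz] mult_right_mono) auto
    qed
    ultimately show "\<exists>d. (?\<phi> has_real_derivative d) (at t) \<and> d \<le> 0"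
      using t by (intro exI conjI) (auto simp: inner_diff_left power2_eq_square algebra_simps)
  qed simp
  then show ?thesis by (simp add: bregman_def h_def)
qed

text \<open>
  Co-coercivity.  A gradient step of length \<open>1 / K\<close> from \<open>x\<close> on the function \<open>\<lambda>v. bregman f v y\<close>
  decreases it by at least \<open>\<parallel>grad f x - grad f y\<parallel>\<^sup>2 / (2 K)\<close>, and it cannot become negative.
\<close>

lemma grad_diff_sq_le_bregman:
  fixes f :: "'a::euclidean_space \<Rightarrow> real"
  assumes "convex_on UNIV f" "smooth_with K f" "0 < K"
  shows "(norm (grad f x - grad f y))\<^sup>2 \<le> 2 * K * bregman f x y"
proof -
  define g where "g = grad f x - grad f y"
  define x' where "x' = x - (1 / K) *\<^sub>R g"
  have "0 \<le> bregman f x' y"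
    using assms by (intro bregman_nonneg) (auto simp: smooth_with_def)
  also have "bregman f x' y = bregman f x' x + bregman f x y + inner g (x' - x)"
    by (simp add: bregman_def g_def inner_simps)
  also have "bregman f x' x \<le> K / 2 * (norm (x' - x))\<^sup>2"
    using assms(2) by (rule bregman_le_smooth)
  also have "K / 2 * (norm (x' - x))\<^sup>2 + bregman f x y + inner g (x' - x)
      = bregman f x y - (norm g)\<^sup>2 / (2 * K)"
    using assms(3) by (simp add: x'_def power2_eq_square field_simps flip: power2_norm_eq_inner)
  finally show ?thesis using assms(3) by (simp add: g_def field_simps)
qed

section \<open>Proximal minimization\<close>

text \<open>
  On the segment from \<open>z\<close> to \<open>w\<close> the quadratic term lies below its chord by exactly
  \<open>c t (1 - t) \<parallel>w - z\<parallel>\<^sup>2\<close>.  Together with the minimality of \<open>z\<close> this gives the claim with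
  \<open>c (1 - t)\<close> in place of the second \<open>c\<close>, and \<open>t\<close> can be sent to \<open>0\<close>.
\<close>

lemma quadratic_growth_at_minimizer:
  fixes h :: "'a::real_inner \<Rightarrow> real"
  assumes "convex_on UNIV h"
    and min: "\<And>w. h z + c * (norm (z - z0))\<^sup>2 \<le> h w + c * (norm (w - z0))\<^sup>2"
  shows "h z + c * (norm (z - z0))\<^sup>2 + c * (norm (w - z))\<^sup>2 \<le> h w + c * (norm (w - z0))\<^sup>2"
proof -
  define \<phi> where "\<phi> w = h w + c * (norm (w - z0))\<^sup>2" for w
  have "0 \<le> (\<phi> w - \<phi> z - c * (norm (w - z))\<^sup>2) + t * (c * (norm (w - z))\<^sup>2)"
    if t: "0 < t" "t < 1" for t
  proof -
    define v where "v = (1 - t) *\<^sub>R z + t *\<^sub>R w"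
    have v: "v - z0 = (1 - t) *\<^sub>R (z - z0) + t *\<^sub>R (w - z0)"
      by (simp add: v_def algebra_simps)
    have "\<phi> z \<le> \<phi> v" using min by (simp add: \<phi>_def)
    also have "h v \<le> (1 - t) * h z + t * h w"
      unfolding v_def using t by (intro convex_onD[OF assms(1)]) auto
    then have "\<phi> v \<le> (1 - t) * \<phi> z + t * \<phi> w - c * t * (1 - t) * (norm (w - z))\<^sup>2"
      unfolding \<phi>_def v norm_sq_combination by (simp add: norm_minus_commute algebra_simps)
    finally have "0 \<le> t * ((\<phi> w - \<phi> z - c * (norm (w - z))\<^sup>2) + t * (c * (norm (w - z))\<^sup>2))"
      by (simp add: algebra_simps)
    then show ?thesis using t by (simp add: zero_le_mult_iff)
  qed
  from nonneg_of_affine_nonneg[OF this] show ?thesis by (simp add: \<phi>_def)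
qed

text \<open>
  A finite convex function decreases at most linearly away from \<open>z0\<close>, at a rate \<open>K\<close> read off from
  its minimum on the unit ball.  The quadratic term outweighs this outside the ball of radius
  \<open>1 + K / c\<close>, and inside that compact ball a minimum is attained.
\<close>

lemma prox_minimizer_exists:
  fixes h :: "'a::euclidean_space \<Rightarrow> real"
  assumes conv: "convex_on UNIV h" and c: "0 < c"
  shows "\<exists>z. is_minimizer (\<lambda>w. h w + c * (norm (w - z0))\<^sup>2) z"
proof -
  define \<phi> where "\<phi> w = h w + c * (norm (w - z0))\<^sup>2" for w
  have conth: "continuous_on A h" for A
    using convex_on_continuous[OF open_UNIV conv] continuous_on_subset by blast
  have cont: "continuous_on A \<phi>" for A
    unfolding \<phi>_def by (intro continuous_intros conth)
  obtain u where u: "\<And>w. w \<in> cball z0 1 \<Longrightarrow> h u \<le> h w"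
    using continuous_attains_inf[OF compact_cball _ conth, of z0 1] by fastforce
  define K where "K = h z0 - h u"
  have K: "0 \<le> K" using u[of z0] by (simp add: K_def)
  define r where "r = 1 + K / c"
  have r: "1 \<le> r" using K c by (simp add: r_def)
  obtain z where z: "z \<in> cball z0 r" "\<And>w. w \<in> cball z0 r \<Longrightarrow> \<phi> z \<le> \<phi> w"
    using continuous_attains_inf[OF compact_cball _ cont, of z0 r] r by fastforce
  have "\<phi> z \<le> \<phi> w" for w
  proof (cases "w \<in> cball z0 r")
    case False
    define d where "d = norm (w - z0)"
    have d: "d > r" using False by (simp add: d_def dist_norm norm_minus_commute)
    \<comment> \<open>The point where the segment from \<open>z0\<close> to \<open>w\<close> crosses the unit sphere around \<open>z0\<close>.\<close>
    define v where "v = (1 - 1 / d) *\<^sub>R z0 + (1 / d) *\<^sub>R w"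
    have "v - z0 = (1 / d) *\<^sub>R (w - z0)" by (simp add: v_def algebra_simps)
    then have "norm (v - z0) = 1" using d r by (auto simp: d_def)
    then have "h u \<le> h v" by (intro u) (simp add: dist_norm norm_minus_commute)
    also have "h v \<le> (1 - 1 / d) * h z0 + (1 / d) * h w"
      unfolding v_def using d r by (intro convex_onD[OF conv]) auto
    finally have "d * h u \<le> d * ((1 - 1 / d) * h z0 + (1 / d) * h w)"
      using d r by (intro mult_left_mono) auto
    also have "\<dots> = (d - 1) * h z0 + h w" using d r by (simp add: field_simps)
    finally have 1: "h z0 - d * K \<le> h w" by (simp add: K_def algebra_simps)
    have "K \<le> c * d" using d c by (simp add: r_def field_simps)
    then have "d * K \<le> d * (c * d)" using d r by (intro mult_left_mono) auto
    then have "\<phi> z0 \<le> \<phi> w" using 1 by (simp add: \<phi>_def d_def power2_eq_square algebra_simps)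
    moreover have "\<phi> z \<le> \<phi> z0" using r by (intro z) auto
    ultimately show ?thesis by simp
  qed (use z in auto)
  then show ?thesis by (auto simp: is_arg_min_linorder \<phi>_def)
qed

section \<open>Expectations over finitely supported distributions\<close>

lemma expectation_bind_finite:
  fixes h :: "'b \<Rightarrow> 'c::{banach, second_countable_topology}"
  assumes "finite (set_pmf p)" "\<And>x. x \<in> set_pmf p \<Longrightarrow> finite (set_pmf (q x))"
  shows "measure_pmf.expectation (bind_pmf p q) h
     = measure_pmf.expectation p (\<lambda>x. measure_pmf.expectation (q x) h)"
  using assms
  by (simp add: pmf_expectation_bind[of "set_pmf p"] integral_measure_pmf[of "set_pmf p"])

lemma expectation_mono_finite:
  fixes g h :: "'a \<Rightarrow> real"
  assumes "finite (set_pmf p)" "\<And>x. x \<in> set_pmf p \<Longrightarrow> g x \<le> h x"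
  shows "measure_pmf.expectation p g \<le> measure_pmf.expectation p h"
  using assms by (intro integral_mono_AE integrable_measure_pmf_finite) (auto simp: AE_measure_pmf_iff)

lemma finite_set_replicate_pmf:
  assumes "finite (set_pmf p)"
  shows "finite (set_pmf (replicate_pmf b p))"
  using finite_lists_length_eq[OF assms, of b] by (simp add: set_replicate_pmf lists_eq_set)

lemma expectation_sum_list_replicate_pmf:
  fixes h :: "'a \<Rightarrow> 'b::euclidean_space"
  assumes fin: "finite (set_pmf p)"
  shows "measure_pmf.expectation (replicate_pmf b p) (\<lambda>I. \<Sum>i\<leftarrow>I. h i)
     = real b *\<^sub>R measure_pmf.expectation p h"
proof (induction b)
  case (Suc b)
  note [simp] = integrable_measure_pmf_finite[OF fin]
    integrable_measure_pmf_finite[OF finite_set_replicate_pmf[OF fin]]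
  show ?case
    by (simp add: expectation_bind_finite fin finite_set_replicate_pmf Suc.IH algebra_simps)
qed simp

text \<open>
  Independent centred terms are orthogonal in expectation, so the cross terms vanish.  This is what
  makes the variance of a minibatch mean decay like \<open>1 / b\<close>.
\<close>

lemma expectation_sum_list_replicate_pmf_sq:
  fixes h :: "'a \<Rightarrow> 'b::euclidean_space"
  assumes fin: "finite (set_pmf p)" and mean0: "measure_pmf.expectation p h = 0"
  shows "measure_pmf.expectation (replicate_pmf b p) (\<lambda>I. (norm (\<Sum>i\<leftarrow>I. h i))\<^sup>2)
     = real b * measure_pmf.expectation p (\<lambda>i. (norm (h i))\<^sup>2)"
proof (induction b)
  case (Suc b)
  note int [simp] = integrable_measure_pmf_finite[OF fin]
    integrable_measure_pmf_finite[OF finite_set_replicate_pmf[OF fin]]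
  have sq: "(norm (v + w))\<^sup>2 = (norm v)\<^sup>2 + 2 * inner v w + (norm w)\<^sup>2" for v w :: 'b
    by (simp add: power2_norm_eq_inner inner_simps inner_commute)
  show ?case
    by (simp add: expectation_bind_finite fin finite_set_replicate_pmf Suc.IH sq
        expectation_sum_list_replicate_pmf mean0 algebra_simps)
qed simp

section \<open>The composite problem and its stochastic gradients\<close>

locale composite_problem =
  fixes n :: nat and f :: "nat \<Rightarrow> 'a::euclidean_space \<Rightarrow> real" and R :: "'a \<Rightarrow> real"
    and L :: "nat \<Rightarrow> real" and xs :: 'a
  assumes n_pos: "1 \<le> n"
    and L_pos: "i \<in> {1..n} \<Longrightarrow> 0 < L i"
    and convex_f: "i \<in> {1..n} \<Longrightarrow> convex_on UNIV (f i)"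
    and smooth_f: "i \<in> {1..n} \<Longrightarrow> smooth_with (L i) (f i)"
    and convex_R: "convex_on UNIV R"
    and minimizer: "is_minimizer (objective n f R) xs"
begin

abbreviation "F \<equiv> avg_fun n f"
abbreviation "P \<equiv> objective n f R"
abbreviation "Lb \<equiv> L_bar n L"
abbreviation "Q \<equiv> sampling_pmf n L"

lemma Lb_pos: "0 < Lb"
  using n_pos L_pos by (auto simp: L_bar_def intro!: sum_pos divide_pos_pos)

lemma P_minimal: "P xs \<le> P x"
  using minimizer by (auto simp: is_arg_min_linorder)

lemma GDERIV_F: "GDERIV F x :> (1 / real n) *\<^sub>R (\<Sum>i = 1..n. grad (f i) x)"
proof -
  have "((\<lambda>x. 1 / real n * (\<Sum>i = 1..n. f i x)) has_derivative
      (\<lambda>h. 1 / real n * (\<Sum>i = 1..n. inner h (grad (f i) x)))) (at x)"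
    using smooth_f GDERIV_grad unfolding smooth_with_def gderiv_def
    by (intro has_derivative_mult_right has_derivative_sum) blast
  then show ?thesis
    by (simp add: gderiv_def avg_fun_def[abs_def] inner_sum_right)
qed

lemma grad_F: "grad F x = (1 / real n) *\<^sub>R (\<Sum>i = 1..n. grad (f i) x)"
  using GDERIV_F by (rule grad_eqI)

lemma bregman_F: "bregman F x y = 1 / real n * (\<Sum>i = 1..n. bregman (f i) x y)"
  unfolding bregman_def grad_F by (simp add: avg_fun_def inner_sum_left sum_subtractf diff_divide_distrib)

lemma bregman_F_nonneg: "0 \<le> bregman F x y"
  using convex_f smooth_f unfolding bregman_F smooth_with_def
  by (intro mult_nonneg_nonneg sum_nonneg bregman_nonneg) auto

lemma bregman_F_le: "bregman F x y \<le> Lb / 2 * (norm (x - y))\<^sup>2"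
proof -
  have "(\<Sum>i = 1..n. bregman (f i) x y) \<le> (\<Sum>i = 1..n. L i / 2 * (norm (x - y))\<^sup>2)"
    by (intro sum_mono bregman_le_smooth smooth_f)
  also have "\<dots> = (\<Sum>i = 1..n. L i) / 2 * (norm (x - y))\<^sup>2"
    by (simp add: sum_divide_distrib sum_distrib_right)
  finally show ?thesis
    unfolding bregman_F L_bar_def using n_pos by (simp add: field_simps)
qed

text \<open>
  By first-order optimality, \<open>- grad F xs\<close> is a subgradient of \<open>R\<close> at \<open>xs\<close>, so the linear term that
  the Bregman distance subtracts from \<open>F x - F xs\<close> is made up for by \<open>R x - R xs\<close>.
\<close>

lemma bregman_F_minimizer_le: "bregman F x xs \<le> P x - P xs"
proof -
  define h where "h = x - xs"
  have "0 \<le> (inner (grad F xs) h + R x - R xs) + t * (Lb / 2 * (norm h)\<^sup>2)"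
    if t: "0 < t" "t < 1" for t
  proof -
    define v where "v = (1 - t) *\<^sub>R xs + t *\<^sub>R x"
    have v: "v - xs = t *\<^sub>R h" by (simp add: v_def h_def algebra_simps)
    have "P xs \<le> P v" by (rule P_minimal)
    moreover have "R v \<le> (1 - t) * R xs + t * R x"
      unfolding v_def using t by (intro convex_onD[OF convex_R]) auto
    moreover have "F v \<le> F xs + t * inner (grad F xs) h + t * (t * (Lb / 2 * (norm h)\<^sup>2))"
      using bregman_F_le[of v xs] unfolding bregman_def v
      by (simp add: power_mult_distrib) (simp add: power2_eq_square algebra_simps)
    ultimately have "0 \<le> t * ((inner (grad F xs) h + R x - R xs) + t * (Lb / 2 * (norm h)\<^sup>2))"
      by (simp add: objective_def algebra_simps)
    then show ?thesis using t by (simp add: zero_le_mult_iff)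
  qed
  from nonneg_of_affine_nonneg[OF this] show ?thesis
    by (simp add: bregman_def objective_def h_def)
qed

lemma pmf_Q: "pmf Q i = (if i \<in> {1..n} then L i / (real n * Lb) else 0)"
  using n_pos L_pos by (rule pmf_sampling_pmf)

lemma set_pmf_Q: "set_pmf Q = {1..n}"
proof -
  have "L i / (real n * Lb) \<noteq> 0" if "i \<in> {1..n}" for i
    using L_pos[OF that] Lb_pos n_pos by auto
  then show ?thesis by (auto simp: set_pmf_eq pmf_Q split: if_splits)
qed

lemma expectation_Q:
  fixes h :: "nat \<Rightarrow> 'c::{banach, second_countable_topology}"
  shows "measure_pmf.expectation Q h = (\<Sum>i = 1..n. (L i / (real n * Lb)) *\<^sub>R h i)"
  by (subst integral_measure_pmf[of "{1..n}"]) (auto simp: set_pmf_Q pmf_Q)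

lemma finite_set_samples: "finite (set_pmf (replicate_pmf b Q))"
  by (simp add: finite_set_replicate_pmf set_pmf_Q)

definition stoch_grad :: "'a \<Rightarrow> nat \<Rightarrow> 'a \<Rightarrow> nat list \<Rightarrow> 'a" where
  "stoch_grad xt b y I = (1 / real b) *\<^sub>R
     (\<Sum>i\<leftarrow>I. (1 / (real n * pmf Q i)) *\<^sub>R (grad (f i) y - grad (f i) xt)) + grad F xt"

text \<open>
  The contribution of a single sampled index to the error of the stochastic gradient, that is, its
  importance-weighted gradient difference minus the mean of that difference.
\<close>

definition noise :: "'a \<Rightarrow> 'a \<Rightarrow> nat \<Rightarrow> 'a" where
  "noise xt y i = (1 / (real n * pmf Q i)) *\<^sub>R (grad (f i) y - grad (f i) xt)
     - (grad F y - grad F xt)"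

text \<open>
  The weights \<open>1 / (n q\<^sub>i)\<close> undo the nonuniform sampling, so the estimate is unbiased.
\<close>

lemma expectation_noise: "measure_pmf.expectation Q (noise xt y) = 0"
proof -
  let ?\<xi> = "\<lambda>i. (1 / (real n * pmf Q i)) *\<^sub>R (grad (f i) y - grad (f i) xt)"
  have "measure_pmf.expectation Q ?\<xi> = (\<Sum>i = 1..n. (1 / real n) *\<^sub>R (grad (f i) y - grad (f i) xt))"
    unfolding expectation_Q
  proof (rule sum.cong[OF refl])
    fix i assume "i \<in> {1..n}"
    then show "(L i / (real n * Lb)) *\<^sub>R ?\<xi> i = (1 / real n) *\<^sub>R (grad (f i) y - grad (f i) xt)"
      using L_pos[of i] Lb_pos n_pos by (simp add: pmf_Q)
  qed
  also have "\<dots> = grad F y - grad F xt"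
    by (simp add: grad_F sum_subtractf scaleR_diff_right flip: scaleR_sum_right)
  finally show ?thesis
    unfolding noise_def
    by (subst Bochner_Integration.integral_diff)
       (auto intro!: integrable_measure_pmf_finite simp: set_pmf_Q)
qed

text \<open>
  Sampling with probability proportional to \<open>L i\<close> turns the individual smoothness constants of the
  co-coercivity bounds into their average \<open>Lb\<close>.  The gradient difference between \<open>xt\<close> and \<open>y\<close> is
  estimated in two ways: directly, with weight \<open>1 - \<alpha>\<close>, and by passing through \<open>xs\<close>, with weight
  \<open>\<alpha>\<close>.  The terms so obtained are those that \<open>lower_model_plus_variance_le_bound\<close> can absorb.
\<close>

lemma expectation_noise_sq:
  assumes \<alpha>: "0 \<le> \<alpha>" "\<alpha> \<le> 1"
  shows "measure_pmf.expectation Q (\<lambda>i. (norm (noise xt y i))\<^sup>2)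
    \<le> 2 * Lb * ((1 - \<alpha>) * bregman F xt y + 2 * \<alpha> * (bregman F xs y + (P xt - P xs)))"
proof -
  define \<xi> where "\<xi> i = (1 / (real n * pmf Q i)) *\<^sub>R (grad (f i) y - grad (f i) xt)" for i
  define G where "G = grad F y - grad F xt"
  define B where "B i = (1 - \<alpha>) * bregman (f i) xt y
      + 2 * \<alpha> * (bregman (f i) xs y + bregman (f i) xt xs)" for i
  have int: "integrable Q h" for h :: "nat \<Rightarrow> 'c::{banach, second_countable_topology}"
    by (rule integrable_measure_pmf_finite) (simp add: set_pmf_Q)
  have noise: "noise xt y = (\<lambda>i. \<xi> i - G)" by (simp add: noise_def fun_eq_iff \<xi>_def G_def)
  have mean: "measure_pmf.expectation Q \<xi> = G"
    using expectation_noise[of xt y] unfolding noise by (simp add: int)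
  have sq: "(norm (v - w))\<^sup>2 = (norm v)\<^sup>2 - 2 * inner v w + (norm w)\<^sup>2" for v w :: 'a
    by (simp add: power2_norm_eq_inner inner_simps inner_commute)
  have "measure_pmf.expectation Q (\<lambda>i. (norm (noise xt y i))\<^sup>2)
      = measure_pmf.expectation Q (\<lambda>i. (norm (\<xi> i))\<^sup>2 - 2 * inner (\<xi> i) G + (norm G)\<^sup>2)"
    by (simp add: noise sq)
  also have "\<dots> = measure_pmf.expectation Q (\<lambda>i. (norm (\<xi> i))\<^sup>2) - (norm G)\<^sup>2"
    by (simp add: int mean) (simp add: power2_norm_eq_inner)
  also have "\<dots> \<le> measure_pmf.expectation Q (\<lambda>i. (norm (\<xi> i))\<^sup>2)" by simp
  also have "\<dots> \<le> (\<Sum>i = 1..n. 2 * Lb / real n * B i)"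
    unfolding expectation_Q real_scaleR_def
  proof (rule sum_mono)
    fix i assume i: "i \<in> {1..n}"
    note co = grad_diff_sq_le_bregman[OF convex_f[OF i] smooth_f[OF i] L_pos[OF i]]
    define p q where "p = grad (f i) xt - grad (f i) xs" and "q = grad (f i) xs - grad (f i) y"
    have pq: "grad (f i) xt - grad (f i) y = p + q" by (simp add: p_def q_def)
    have "(norm (p + q))\<^sup>2 + (norm (p - q))\<^sup>2 = 2 * (norm p)\<^sup>2 + 2 * (norm q)\<^sup>2"
      by (simp add: power2_norm_eq_inner inner_simps inner_commute)
    then have "(norm (p + q))\<^sup>2 \<le> 2 * (norm p)\<^sup>2 + 2 * (norm q)\<^sup>2"
      using zero_le_power2[of "norm (p - q)"] by linarith
    also have "\<dots> \<le> 2 * L i * (2 * (bregman (f i) xs y + bregman (f i) xt xs))"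
      using co[of xt xs] co[of xs y] by (simp add: p_def q_def algebra_simps)
    finally have "\<alpha> * (norm (p + q))\<^sup>2
        \<le> \<alpha> * (2 * L i * (2 * (bregman (f i) xs y + bregman (f i) xt xs)))"
      using \<alpha>(1) by (rule mult_left_mono)
    moreover have "(1 - \<alpha>) * (norm (p + q))\<^sup>2 \<le> (1 - \<alpha>) * (2 * L i * bregman (f i) xt y)"
      using co[of xt y] \<alpha> by (intro mult_left_mono) (auto simp: pq)
    ultimately have "(norm (p + q))\<^sup>2 \<le> 2 * L i * B i"
      by (simp add: B_def algebra_simps)
    then have "(norm (grad (f i) y - grad (f i) xt))\<^sup>2 \<le> 2 * L i * B i"
      by (simp add: norm_minus_commute flip: pq)
    then have "Lb / (real n * L i) * (norm (grad (f i) y - grad (f i) xt))\<^sup>2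
        \<le> Lb / (real n * L i) * (2 * L i * B i)"
      using Lb_pos L_pos[OF i] by (intro mult_left_mono) auto
    moreover have "L i / (real n * Lb) * (norm (\<xi> i))\<^sup>2
        = Lb / (real n * L i) * (norm (grad (f i) y - grad (f i) xt))\<^sup>2"
      using i L_pos[OF i] Lb_pos n_pos
      by (simp add: \<xi>_def pmf_Q power_mult_distrib power_divide) (simp add: power2_eq_square field_simps)
    ultimately show "L i / (real n * Lb) * (norm (\<xi> i))\<^sup>2 \<le> 2 * Lb / real n * B i"
      using L_pos[OF i] by (simp add: ac_simps)
  qed
  also have "\<dots> = 2 * Lb * (1 / real n * (\<Sum>i = 1..n. B i))"
    by (simp add: sum_distrib_left)
  also have "1 / real n * (\<Sum>i = 1..n. B i)
      = (1 - \<alpha>) * bregman F xt y + 2 * \<alpha> * (bregman F xs y + bregman F xt xs)"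
    by (simp add: B_def bregman_F sum.distrib distrib_left add_divide_distrib flip: sum_distrib_left)
  also have "2 * Lb * ((1 - \<alpha>) * bregman F xt y + 2 * \<alpha> * (bregman F xs y + bregman F xt xs))
      \<le> 2 * Lb * ((1 - \<alpha>) * bregman F xt y + 2 * \<alpha> * (bregman F xs y + (P xt - P xs)))"
    using Lb_pos \<alpha> bregman_F_minimizer_le[of xt]
    by (intro mult_left_mono add_left_mono) auto
  finally show ?thesis .
qed

lemma stoch_grad_error:
  assumes "I \<in> set_pmf (replicate_pmf b Q)" "1 \<le> b"
  shows "stoch_grad xt b y I - grad F y = (1 / real b) *\<^sub>R (\<Sum>i\<leftarrow>I. noise xt y i)"
proof -
  have "(\<Sum>i\<leftarrow>I. noise xt y i)
      = (\<Sum>i\<leftarrow>I. (1 / (real n * pmf Q i)) *\<^sub>R (grad (f i) y - grad (f i) xt))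
        - real (length I) *\<^sub>R (grad F y - grad F xt)"
    by (induction I) (simp_all add: noise_def algebra_simps)
  moreover have "length I = b" using assms(1) by (simp add: set_replicate_pmf)
  ultimately show ?thesis
    using assms(2) by (simp add: stoch_grad_def scaleR_diff_right)
qed

lemma expectation_stoch_grad_error:
  assumes "1 \<le> b"
  shows "measure_pmf.expectation (replicate_pmf b Q)
      (\<lambda>I. inner (stoch_grad xt b y I - grad F y) v) = 0"
proof -
  have "measure_pmf.expectation (replicate_pmf b Q) (\<lambda>I. inner (stoch_grad xt b y I - grad F y) v)
      = measure_pmf.expectation (replicate_pmf b Q)
          (\<lambda>I. inner ((1 / real b) *\<^sub>R (\<Sum>i\<leftarrow>I. noise xt y i)) v)"
    by (intro integral_cong_AE) (auto simp: AE_measure_pmf_iff stoch_grad_error[OF _ assms])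
  also have "\<dots> = inner ((1 / real b) *\<^sub>R measure_pmf.expectation (replicate_pmf b Q)
          (\<lambda>I. \<Sum>i\<leftarrow>I. noise xt y i)) v"
    by (simp add: integrable_measure_pmf_finite finite_set_samples)
  also have "\<dots> = 0"
    by (simp add: expectation_sum_list_replicate_pmf set_pmf_Q expectation_noise)
  finally show ?thesis .
qed

lemma expectation_stoch_grad_error_sq:
  assumes "1 \<le> b" "0 \<le> \<alpha>" "\<alpha> \<le> 1"
  shows "measure_pmf.expectation (replicate_pmf b Q)
      (\<lambda>I. (norm (stoch_grad xt b y I - grad F y))\<^sup>2)
    \<le> 2 * Lb / real b * ((1 - \<alpha>) * bregman F xt y + 2 * \<alpha> * (bregman F xs y + (P xt - P xs)))"
proof -
  have "measure_pmf.expectation (replicate_pmf b Q) (\<lambda>I. (norm (stoch_grad xt b y I - grad F y))\<^sup>2)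
      = measure_pmf.expectation (replicate_pmf b Q)
          (\<lambda>I. (1 / real b)\<^sup>2 * (norm (\<Sum>i\<leftarrow>I. noise xt y i))\<^sup>2)"
    by (intro integral_cong_AE)
       (auto simp: AE_measure_pmf_iff stoch_grad_error[OF _ assms(1)] power_mult_distrib power_divide)
  also have "\<dots> = 1 / real b * measure_pmf.expectation Q (\<lambda>i. (norm (noise xt y i))\<^sup>2)"
    by (simp add: expectation_sum_list_replicate_pmf_sq set_pmf_Q expectation_noise)
       (simp add: power2_eq_square)
  also have "\<dots> \<le> 1 / real b * (2 * Lb * ((1 - \<alpha>) * bregman F xt y
      + 2 * \<alpha> * (bregman F xs y + (P xt - P xs))))"
    using assms by (intro mult_left_mono expectation_noise_sq) auto
  finally show ?thesis by simp
qed

end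

section \<open>One inner stage\<close>

text \<open>
  The total weight of the first \<open>k\<close> steps: step \<open>j\<close> has weight \<open>j / 2\<close>, which is \<open>\<theta> (j - 1)\<close>.
\<close>

definition accum :: "nat \<Rightarrow> real" where
  "accum k = real k * (real k + 1) / 4"

lemma accum_eq_theta: "accum (Suc k) = \<theta> (Suc k) * \<theta> k"
  by (simp add: accum_def \<theta>_def)

lemma accum_Suc: "accum (Suc k) = accum k + (real k + 1) / 2"
  by (simp add: accum_def field_simps)

text \<open>
  Multiplying by \<open>accum (Suc k)\<close> converts the averaging weights of the algorithm into the previous
  total weight and the weight of the new step.
\<close>

lemma accum_theta:
  shows "accum (Suc k) * (1 - 1 / \<theta> (Suc k)) = accum k"
    and "accum (Suc k) * (1 / \<theta> (Suc k)) = (real k + 1) / 2"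
proof -
  have "real k + 2 \<noteq> 0" by linarith
  then show "accum (Suc k) * (1 - 1 / \<theta> (Suc k)) = accum k"
    and "accum (Suc k) * (1 / \<theta> (Suc k)) = (real k + 1) / 2"
    unfolding accum_def \<theta>_def by (simp_all add: divide_simps) (simp_all add: algebra_simps)
qed

text \<open>
  The parameter \<open>\<alpha>\<close> is the weight of the minimizer in the comparison point; it enters only the
  analysis, and the outer loop fixes it to the reciprocal of the outer weight.
\<close>

locale inner_stage = composite_problem +
  fixes yt xt :: 'a and \<gamma> \<eta> \<alpha> :: real and m b :: nat
  assumes m_pos: "1 \<le> m" and b_pos: "1 \<le> b" and \<gamma>: "1 \<le> \<gamma>"
    and \<eta>_eq: "\<eta> = step_size \<gamma> m b Lb"
    and \<alpha>_nonneg: "0 \<le> \<alpha>" and \<alpha>_le_1: "\<alpha> \<le> 1"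
begin

definition "u = (1 - \<alpha>) *\<^sub>R xt + \<alpha> *\<^sub>R xs"

text \<open>
  The proximal problem of step \<open>k\<close>, multiplied by \<open>accum k\<close>.  In this scaling the quadratic term is
  the same for all \<open>k\<close>, so a step only adds a multiple of \<open>inner g w + R w\<close>.
\<close>

definition model :: "nat \<Rightarrow> 'a \<Rightarrow> 'a \<Rightarrow> real" where
  "model k gbar w = accum k * (inner gbar w + R w) + 1 / (2 * \<eta>) * (norm (w - yt))\<^sup>2"

text \<open>
  The invariant that \<open>z\<close> minimizes the current model, in the form given by strong convexity.
\<close>

definition strong_min :: "nat \<Rightarrow> 'a \<times> 'a \<times> 'a \<Rightarrow> bool" where
  "strong_min k = (\<lambda>(x, z, gbar).
     \<forall>w. model k gbar z + 1 / (2 * \<eta>) * (norm (w - z))\<^sup>2 \<le> model k gbar w)"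

text \<open>
  Only differences of \<open>model\<close> occur, so the constants of the linearizations collected so far cancel
  and the potential is a function of the current state.
\<close>

definition potential :: "nat \<Rightarrow> 'a \<times> 'a \<times> 'a \<Rightarrow> real" where
  "potential k = (\<lambda>(x, z, gbar). accum k * P x - (model k gbar z - model k gbar u))"

definition extrapolate :: "nat \<Rightarrow> 'a \<times> 'a \<times> 'a \<Rightarrow> 'a" where
  "extrapolate k = (\<lambda>(x, z, gbar). (1 - 1 / \<theta> k) *\<^sub>R x + (1 / \<theta> k) *\<^sub>R z)"

abbreviation "step k I st \<equiv> one_stage_step n f R yt xt \<eta> b Q k I st"
abbreviation "iterates k \<equiv> one_stage_iter n f R yt xt \<eta> b Q k"
abbreviation "samples \<equiv> replicate_pmf b Q"

lemma inverse_\<eta>: "1 / \<eta> = Lb + \<gamma> * (real m + 1) / real b * Lb"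
  by (simp add: \<eta>_eq step_size_def algebra_simps)

lemma \<eta>_pos: "0 < \<eta>"
  using Lb_pos \<gamma> b_pos
  by (auto simp: \<eta>_eq step_size_def intro!: mult_pos_pos add_pos_nonneg)

lemma convex_linear_plus_R: "convex_on UNIV (\<lambda>w. inner g w + R w)"
proof (rule convex_onI)
  fix t :: real and v w :: 'a assume "0 < t" "t < 1"
  then have "R ((1 - t) *\<^sub>R v + t *\<^sub>R w) \<le> (1 - t) * R v + t * R w"
    by (intro convex_onD[OF convex_R]) auto
  then show "inner g ((1 - t) *\<^sub>R v + t *\<^sub>R w) + R ((1 - t) *\<^sub>R v + t *\<^sub>R w)
      \<le> (1 - t) * (inner g v + R v) + t * (inner g w + R w)"
    by (simp add: inner_simps algebra_simps)
qed simp

lemma strong_min_prox: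
  assumes "0 \<le> accum k" "\<And>w. model k gbar z \<le> model k gbar w"
  shows "strong_min k (x, z, gbar)"
proof -
  have "convex_on UNIV (\<lambda>w. accum k * (inner gbar w + R w))"
    using assms(1) by (intro convex_on_cmul convex_linear_plus_R)
  from quadratic_growth_at_minimizer[OF this, of z "1 / (2 * \<eta>)" yt] assms(2)
  show ?thesis by (simp add: strong_min_def model_def)
qed

lemma strong_min_0: "strong_min 0 (yt, yt, 0)"
  using \<eta>_pos by (intro strong_min_prox) (auto simp: accum_def model_def)

lemma step_components:
  fixes I st k
  defines "g \<equiv> stoch_grad xt b (extrapolate (Suc k) st) I"
  assumes st: "st = (x, z, gbar)"
  obtains z' gbar' where
    "step (Suc k) I st = ((1 - 1 / \<theta> (Suc k)) *\<^sub>R x + (1 / \<theta> (Suc k)) *\<^sub>R z', z', gbar')"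
    "strong_min (Suc k) (step (Suc k) I st)"
    "\<And>w. model (Suc k) gbar' w = model k gbar w + (real k + 1) / 2 * (inner g w + R w)"
proof -
  define gbar' where "gbar' = (1 - 1 / \<theta> (Suc k)) *\<^sub>R gbar + (1 / \<theta> (Suc k)) *\<^sub>R g"
  let ?\<phi> = "\<lambda>w. inner gbar' w + R w
      + 1 / (2 * \<eta> * \<theta> (Suc k) * \<theta> (Suc k - 1)) * (norm (w - yt))\<^sup>2"
  define z' where "z' = arg_min ?\<phi> (\<lambda>_. True)"
  have step: "step (Suc k) I st
      = ((1 - 1 / \<theta> (Suc k)) *\<^sub>R x + (1 / \<theta> (Suc k)) *\<^sub>R z', z', gbar')"
    by (simp add: one_stage_step_def Let_def st z'_def gbar'_def g_def stoch_grad_def extrapolate_def)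
  have acc: "0 < accum (Suc k)" by (simp add: accum_def)
  have model: "model (Suc k) gbar' w = accum (Suc k) * ?\<phi> w" for w
    unfolding model_def accum_eq_theta using \<eta>_pos
    by (simp add: \<theta>_def divide_simps)
  have "is_minimizer ?\<phi> z'"
    unfolding z'_def arg_min_def
  proof (rule someI_ex, rule prox_minimizer_exists)
    show "convex_on UNIV (\<lambda>w. inner gbar' w + R w)"
      by (rule convex_linear_plus_R)
    show "0 < 1 / (2 * \<eta> * \<theta> (Suc k) * \<theta> (Suc k - 1))"
      using \<eta>_pos by (simp add: \<theta>_def)
  qed
  then have "model (Suc k) gbar' z' \<le> model (Suc k) gbar' w" for w
    unfolding model using acc by (intro mult_left_mono) (auto simp: is_arg_min_linorder)
  then have "strong_min (Suc k) (step (Suc k) I st)"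
    unfolding step using acc by (intro strong_min_prox) auto
  moreover have "model (Suc k) gbar' w = model k gbar w + (real k + 1) / 2 * (inner g w + R w)" for w
  proof -
    have "accum (Suc k) * inner gbar' w = (accum (Suc k) * (1 - 1 / \<theta> (Suc k))) * inner gbar w
        + (accum (Suc k) * (1 / \<theta> (Suc k))) * inner g w"
      unfolding gbar'_def inner_add_left inner_scaleR_left by (simp only: distrib_left mult.assoc)
    then have "accum (Suc k) * inner gbar' w = accum k * inner gbar w + (real k + 1) / 2 * inner g w"
      by (simp only: accum_theta)
    then show ?thesis
      unfolding model_def by (simp add: distrib_left accum_Suc distrib_right)
  qed
  ultimately show ?thesis by (intro that[OF step])
qed

definition "c = 1 / \<eta> - Lb"

lemma c_eq: "c = \<gamma> * (real m + 1) / real b * Lb"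
  by (simp add: c_def inverse_\<eta>)

lemma c_pos: "0 < c"
  unfolding c_eq using Lb_pos \<gamma> b_pos by (intro mult_pos_pos divide_pos_pos) auto

text \<open>
  The one-step inequality for a fixed sample.  Smoothness bounds \<open>F\<close> at the new point by its
  linearization at \<open>y\<close> plus \<open>Lb / 2\<close> times the squared move of \<open>z\<close>; the model gains \<open>1 / (2 \<eta>)\<close>
  times the same square by strong convexity.  The excess \<open>c / 2\<close> of the second coefficient over the
  first pays, by Young's inequality, for the correlation of the gradient error with the move of \<open>z\<close>.
  The remaining error term pairs \<open>\<delta>\<close> with a vector that does not depend on the sample.
\<close>

lemma potential_step:
  fixes x z gbar :: 'a and k :: nat and I :: "nat list"
  defines "st \<equiv> (x, z, gbar)"
  defines "y \<equiv> extrapolate (Suc k) st"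
  defines "\<delta> \<equiv> stoch_grad xt b y I - grad F y"
  defines "a \<equiv> (real k + 1) / 2"
  assumes min: "strong_min k st"
  shows "potential (Suc k) (step (Suc k) I st)
    \<le> potential k st + a * (F y + inner (grad F y) (u - y) + R u)
      + a\<^sup>2 / (2 * c) * (norm \<delta>)\<^sup>2 - a * inner \<delta> (z - u)"
proof -
  define g where "g = stoch_grad xt b y I"
  obtain z' gbar' where
    step: "step (Suc k) I st = ((1 - 1 / \<theta> (Suc k)) *\<^sub>R x + (1 / \<theta> (Suc k)) *\<^sub>R z', z', gbar')"
    and model: "\<And>w. model (Suc k) gbar' w = model k gbar w + a * (inner g w + R w)"
    using step_components[of st x z gbar k I] unfolding st_def[symmetric] y_def[symmetric]
      g_def[symmetric] a_def[symmetric] by (metis (no_types) st_def)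
  define \<beta> where "\<beta> = 1 / \<theta> (Suc k)"
  define x' where "x' = (1 - \<beta>) *\<^sub>R x + \<beta> *\<^sub>R z'"
  define A A' where "A = accum k" and "A' = accum (Suc k)"
  have \<beta>: "0 \<le> \<beta>" "\<beta> \<le> 1" by (simp_all add: \<beta>_def \<theta>_def)
  have a: "0 \<le> a" by (simp add: a_def)
  have A: "0 \<le> A" "0 \<le> A'" by (simp_all add: A_def A'_def accum_def)
  have acc: "A' * (1 - \<beta>) = A" "A' * \<beta> = a" "A' = A + a"
    unfolding A_def A'_def \<beta>_def a_def using accum_theta accum_Suc by auto
  have a\<beta>: "a * \<beta> \<le> 1" by (simp add: a_def \<beta>_def \<theta>_def field_simps)
  have y: "y = (1 - \<beta>) *\<^sub>R x + \<beta> *\<^sub>R z" by (simp add: y_def st_def extrapolate_def \<beta>_def)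
  have x'y: "x' - y = \<beta> *\<^sub>R (z' - z)" by (simp add: x'_def y algebra_simps)
  have "A' * F x' \<le> A' * (F y + inner (grad F y) (x' - y) + Lb / 2 * (norm (x' - y))\<^sup>2)"
    using bregman_F_le[of x' y] A by (intro mult_left_mono) (auto simp: bregman_def)
  also have "\<dots> = (A + a) * F y + (A' * \<beta>) * inner (grad F y) (z' - z)
      + (A' * \<beta>) * \<beta> * (Lb / 2 * (norm (z' - z))\<^sup>2)"
    unfolding x'y acc(3)[symmetric]
    by (simp add: power_mult_distrib distrib_left) (simp add: power2_eq_square)
  also have "\<dots> \<le> (A + a) * F y + a * inner (grad F y) (z' - z) + Lb / 2 * (norm (z' - z))\<^sup>2"
    unfolding acc(2) using mult_right_mono[OF a\<beta>, of "Lb / 2 * (norm (z' - z))\<^sup>2"] Lb_pos by simp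
  also have "a * inner (grad F y) (z' - z)
      = A * inner (grad F y) (x - y) + a * inner (grad F y) (z' - y)"
  proof -
    \<comment> \<open>\<open>y\<close> is the weighted mean of \<open>x\<close> and \<open>z\<close>, so the first-order terms there cancel.\<close>
    have "A *\<^sub>R (x - y) + a *\<^sub>R (z - y) = A' *\<^sub>R ((1 - \<beta>) *\<^sub>R x + \<beta> *\<^sub>R z) - A' *\<^sub>R y"
      unfolding scaleR_add_right scaleR_scaleR acc(1,2) by (simp add: acc(3) algebra_simps)
    then have "A *\<^sub>R (x - y) + a *\<^sub>R (z - y) = 0" by (simp add: y)
    from arg_cong[OF this, of "inner (grad F y)"] show ?thesis
      by (simp add: inner_simps algebra_simps)
  qed
  also have "(A + a) * F y + (A * inner (grad F y) (x - y) + a * inner (grad F y) (z' - y))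
        + Lb / 2 * (norm (z' - z))\<^sup>2
      = A * (F y + inner (grad F y) (x - y)) + a * (F y + inner (grad F y) (z' - y))
        + Lb / 2 * (norm (z' - z))\<^sup>2"
    by (simp add: algebra_simps)
  also have "A * (F y + inner (grad F y) (x - y)) \<le> A * F x"
    using bregman_F_nonneg[of x y] A by (intro mult_left_mono) (auto simp: bregman_def)
  finally have Fx': "A' * F x' \<le> A * F x + a * (F y + inner (grad F y) (z' - y))
      + Lb / 2 * (norm (z' - z))\<^sup>2"
    by simp
  have "A' * R x' \<le> A' * ((1 - \<beta>) * R x + \<beta> * R z')"
    unfolding x'_def using \<beta> A by (intro mult_left_mono convex_onD[OF convex_R]) auto
  also have "\<dots> = A * R x + a * R z'"
    by (simp add: distrib_left acc(1,2) flip: mult.assoc)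
  finally have Rx': "A' * R x' \<le> A * R x + a * R z'" .
  have G: "model k gbar z + 1 / (2 * \<eta>) * (norm (z' - z))\<^sup>2 \<le> model k gbar z'"
    using min by (auto simp: strong_min_def st_def)
  have young: "- a * inner \<delta> (z' - z) \<le> a\<^sup>2 / (2 * c) * (norm \<delta>)\<^sup>2 + c / 2 * (norm (z' - z))\<^sup>2"
  proof -
    \<comment> \<open>Young's inequality, by completing the square with the weight \<open>a / c\<close>.\<close>
    have "0 \<le> (norm ((a / c) *\<^sub>R \<delta> + (z' - z)))\<^sup>2" by simp
    also have "\<dots> = (a / c)\<^sup>2 * (norm \<delta>)\<^sup>2 + 2 * (a / c) * inner \<delta> (z' - z) + (norm (z' - z))\<^sup>2"
      unfolding power2_norm_eq_inner
      by (simp add: inner_add_left inner_add_right inner_commute power2_eq_square)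
    finally have "0 \<le> c / 2 * ((a / c)\<^sup>2 * (norm \<delta>)\<^sup>2 + 2 * (a / c) * inner \<delta> (z' - z)
        + (norm (z' - z))\<^sup>2)"
      using c_pos by (intro mult_nonneg_nonneg) auto
    also have "\<dots> = a\<^sup>2 / (2 * c) * (norm \<delta>)\<^sup>2 + a * inner \<delta> (z' - z) + c / 2 * (norm (z' - z))\<^sup>2"
      using c_pos by (simp add: power2_eq_square distrib_left)
    finally show ?thesis by simp
  qed
  have c2: "c / 2 * r = 1 / (2 * \<eta>) * r - Lb / 2 * r" for r
    by (simp add: c_def algebra_simps diff_divide_distrib)
  have g\<delta>: "a * inner (grad F y) (z' - y) - a * inner g (z' - u)
      = a * inner (grad F y) (u - y) - a * inner \<delta> (z' - z) - a * inner \<delta> (z - u)"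
    by (simp add: \<delta>_def g_def inner_simps algebra_simps)
  have "potential (Suc k) (step (Suc k) I st)
      = A' * F x' + A' * R x' - (model k gbar z' - model k gbar u
          + a * inner g (z' - u) + a * R z' - a * R u)"
    unfolding potential_def step
    by (simp add: model objective_def x'_def \<beta>_def A'_def inner_diff_right algebra_simps)
  also have "\<dots> \<le> A * P x - (model k gbar z - model k gbar u)
      + a * (F y + inner (grad F y) (u - y) + R u)
      + a\<^sup>2 / (2 * c) * (norm \<delta>)\<^sup>2 - a * inner \<delta> (z - u)"
    using Fx' Rx' G young g\<delta> unfolding c2 objective_def distrib_left by linarith
  finally show ?thesis by (simp add: potential_def st_def A_def)
qed

definition "bound = P xs + (1 - \<alpha> * (1 - 1 / \<gamma>)) * (P xt - P xs)"

text \<open>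
  The linearization at \<open>y\<close>, evaluated at the convex combination \<open>u\<close>, falls short of the combination
  of values of \<open>F\<close> by \<open>(1 - \<alpha>) bregman F xt y + \<alpha> bregman F xs y\<close>.  Since \<open>2 t \<le> 1\<close>, this shortfall
  absorbs all Bregman terms of the variance bound.  The last term of that bound is at most
  \<open>\<alpha> / \<gamma> (P xt - P xs)\<close> and accounts for the loss \<open>1 - 1 / \<gamma>\<close> in \<open>bound\<close>.
\<close>

lemma lower_model_plus_variance_le_bound:
  assumes "0 \<le> t" "t \<le> 1 / (2 * \<gamma>)"
  shows "F y + inner (grad F y) (u - y) + R u
    + t * ((1 - \<alpha>) * bregman F xt y + 2 * \<alpha> * (bregman F xs y + (P xt - P xs))) \<le> bound"
proof -
  have u: "u - y = (1 - \<alpha>) *\<^sub>R (xt - y) + \<alpha> *\<^sub>R (xs - y)"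
    by (simp add: u_def algebra_simps)
  have R: "R u \<le> (1 - \<alpha>) * R xt + \<alpha> * R xs"
    unfolding u_def using \<alpha>_nonneg \<alpha>_le_1 by (intro convex_onD[OF convex_R]) auto
  have lin: "F y + inner (grad F y) (u - y)
      = (1 - \<alpha>) * (F xt - bregman F xt y) + \<alpha> * (F xs - bregman F xs y)"
    unfolding u by (simp add: bregman_def inner_add_right algebra_simps)
  have t2: "2 * t \<le> 1 / \<gamma>" using assms(2) by simp
  also have "1 / \<gamma> \<le> 1" using \<gamma> by simp
  finally have t1: "2 * t \<le> 1" .
  have 1: "t * ((1 - \<alpha>) * bregman F xt y) \<le> (1 - \<alpha>) * bregman F xt y"
    using t1 assms(1) \<alpha>_le_1 bregman_F_nonneg[of xt y] by (intro mult_left_le_one_le) auto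
  have 2: "(2 * t) * (\<alpha> * bregman F xs y) \<le> \<alpha> * bregman F xs y"
    using t1 assms(1) \<alpha>_nonneg bregman_F_nonneg[of xs y] by (intro mult_left_le_one_le) auto
  have 3: "(2 * t) * (\<alpha> * (P xt - P xs)) \<le> (1 / \<gamma>) * (\<alpha> * (P xt - P xs))"
    using t2 \<alpha>_nonneg P_minimal[of xt] by (intro mult_right_mono) auto
  from 1 2 3 R show ?thesis
    unfolding lin bound_def objective_def by (simp add: algebra_simps)
qed

text \<open>
  The step size gives \<open>c = \<gamma> (m + 1) Lb / b\<close>, so the variance enters with the factor
  \<open>a / (\<gamma> (m + 1))\<close>, where \<open>a\<close> is the weight of the step.  As \<open>a \<le> m / 2\<close>, this factor is at most
  \<open>1 / (2 \<gamma>)\<close>, as the absorption of the variance requires.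
\<close>

lemma expected_potential_step:
  assumes min: "strong_min k st" and k: "k < m"
  shows "measure_pmf.expectation samples (\<lambda>I. potential (Suc k) (step (Suc k) I st))
    \<le> potential k st + (real k + 1) / 2 * bound"
proof -
  obtain x z gbar where st: "st = (x, z, gbar)" by (cases st)
  define y where "y = extrapolate (Suc k) st"
  define a where "a = (real k + 1) / 2"
  define D where "D = (1 - \<alpha>) * bregman F xt y + 2 * \<alpha> * (bregman F xs y + (P xt - P xs))"
  define \<delta> where "\<delta> I = stoch_grad xt b y I - grad F y" for I
  have int: "integrable samples h" for h :: "nat list \<Rightarrow> real"
    by (intro integrable_measure_pmf_finite finite_set_samples)
  have mean: "measure_pmf.expectation samples (\<lambda>I. inner (\<delta> I) (z - u)) = 0"
    unfolding \<delta>_def using b_pos by (rule expectation_stoch_grad_error)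
  have var: "measure_pmf.expectation samples (\<lambda>I. (norm (\<delta> I))\<^sup>2) \<le> 2 * Lb / real b * D"
    unfolding \<delta>_def D_def using b_pos \<alpha>_nonneg \<alpha>_le_1 by (rule expectation_stoch_grad_error_sq)
  have a: "0 < a" "2 * a \<le> real m" using k by (auto simp: a_def)
  have "a / (real m + 1) \<le> 1 / 2" using a by (simp add: field_simps)
  from divide_right_mono[OF this, of \<gamma>]
  have "a / (\<gamma> * (real m + 1)) \<le> 1 / (2 * \<gamma>)" using \<gamma> by (simp add: mult.commute)
  moreover have "0 \<le> a / (\<gamma> * (real m + 1))" using a \<gamma> by simp
  ultimately have bnd: "F y + inner (grad F y) (u - y) + R u + a / (\<gamma> * (real m + 1)) * D \<le> bound"
    unfolding D_def by (intro lower_model_plus_variance_le_bound)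
  have "measure_pmf.expectation samples (\<lambda>I. potential (Suc k) (step (Suc k) I st))
      \<le> measure_pmf.expectation samples (\<lambda>I. potential k st
          + a * (F y + inner (grad F y) (u - y) + R u)
          + a\<^sup>2 / (2 * c) * (norm (\<delta> I))\<^sup>2 - a * inner (\<delta> I) (z - u))"
    using potential_step[OF min[unfolded st]]
    by (intro expectation_mono_finite finite_set_samples) (simp add: st \<delta>_def y_def a_def)
  also have "\<dots> = potential k st + a * (F y + inner (grad F y) (u - y) + R u)
          + a\<^sup>2 / (2 * c) * measure_pmf.expectation samples (\<lambda>I. (norm (\<delta> I))\<^sup>2)"
    by (simp add: int mean)
  also have "\<dots> \<le> potential k st + a * (F y + inner (grad F y) (u - y) + R u)
          + a\<^sup>2 / (2 * c) * (2 * Lb / real b * D)"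
    using var c_pos by (intro add_left_mono mult_left_mono) auto
  also have "a\<^sup>2 / (2 * c) * (2 * Lb / real b * D) = a * (a / (\<gamma> * (real m + 1)) * D)"
    unfolding c_eq using Lb_pos b_pos \<gamma> by (simp add: power2_eq_square)
  also have "potential k st + a * (F y + inner (grad F y) (u - y) + R u)
          + a * (a / (\<gamma> * (real m + 1)) * D)
      = potential k st + a * (F y + inner (grad F y) (u - y) + R u + a / (\<gamma> * (real m + 1)) * D)"
    by (simp add: distrib_left)
  also have "\<dots> \<le> potential k st + a * bound"
    using bnd a by (intro add_left_mono mult_left_mono) auto
  finally show ?thesis by (simp add: a_def)
qed

lemma finite_set_iterates: "finite (set_pmf (iterates k))"
  by (induction k) (auto simp: finite_set_samples)

lemma strong_min_iterates: "st \<in> set_pmf (iterates k) \<Longrightarrow> strong_min k st"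
proof (induction k arbitrary: st)
  case 0
  then show ?case using strong_min_0 by simp
next
  case (Suc k)
  then obtain st' I where st: "st = step (Suc k) I st'" by auto
  obtain x z gbar where "st' = (x, z, gbar)" by (cases st')
  then show ?case unfolding st by (rule step_components)
qed

lemma expected_potential_iterates:
  "k \<le> m \<Longrightarrow> measure_pmf.expectation (iterates k) (potential k)
    \<le> accum k * bound + 1 / (2 * \<eta>) * (norm (yt - u))\<^sup>2"
proof (induction k)
  case 0
  show ?case
    by (simp add: potential_def model_def accum_def norm_minus_commute)
next
  case (Suc k)
  have "measure_pmf.expectation (iterates (Suc k)) (potential (Suc k))
      = measure_pmf.expectation (iterates k)
          (\<lambda>st. measure_pmf.expectation samples (\<lambda>I. potential (Suc k) (step (Suc k) I st)))"
    by (simp add: expectation_bind_finite finite_set_iterates finite_set_samples)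
  also have "\<dots> \<le> measure_pmf.expectation (iterates k)
      (\<lambda>st. potential k st + (real k + 1) / 2 * bound)"
    using Suc.prems
    by (intro expectation_mono_finite finite_set_iterates expected_potential_step
        strong_min_iterates) auto
  also have "\<dots> = measure_pmf.expectation (iterates k) (potential k) + (real k + 1) / 2 * bound"
    by (simp add: integrable_measure_pmf_finite finite_set_iterates)
  also have "\<dots> \<le> accum (Suc k) * bound + 1 / (2 * \<eta>) * (norm (yt - u))\<^sup>2"
    using Suc by (simp add: accum_Suc distrib_right)
  finally show ?case .
qed

text \<open>
  At the end of the stage, the quadratic growth of the model at its minimizer \<open>z\<close>, evaluated at \<open>u\<close>,
  turns the model gap in the potential into the distance from \<open>z\<close> to \<open>u\<close>.
\<close>

theorem inner_stage_bound:
  "measure_pmf.expectation (one_stage_AccSVRDA n f R yt xt \<eta> m b Q)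
      (\<lambda>(x, z). P x - P xs + 2 / (\<eta> * (real m + 1) * real m) * (norm (z - u))\<^sup>2)
    \<le> (1 - \<alpha> * (1 - 1 / \<gamma>)) * (P xt - P xs)
      + 2 / (\<eta> * (real m + 1) * real m) * (norm (yt - u))\<^sup>2"
proof -
  define A where "A = accum m"
  have A: "0 < A" using m_pos by (simp add: A_def accum_def)
  have C: "2 / (\<eta> * (real m + 1) * real m) = 1 / (2 * \<eta>) / A"
    by (simp add: A_def accum_def field_simps)
  have "measure_pmf.expectation (iterates m)
      (\<lambda>(x, z, gbar). P x - P xs + 1 / (2 * \<eta>) / A * (norm (z - u))\<^sup>2)
    \<le> measure_pmf.expectation (iterates m) (\<lambda>st. potential m st / A - P xs)"
  proof (rule expectation_mono_finite[OF finite_set_iterates])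
    fix st assume st: "st \<in> set_pmf (iterates m)"
    obtain x z gbar where eq: "st = (x, z, gbar)" by (cases st)
    have "model m gbar z + 1 / (2 * \<eta>) * (norm (u - z))\<^sup>2 \<le> model m gbar u"
      using strong_min_iterates[OF st] by (simp add: strong_min_def eq)
    then have "A * P x + 1 / (2 * \<eta>) * (norm (z - u))\<^sup>2 \<le> potential m st"
      by (simp add: potential_def eq A_def norm_minus_commute)
    from divide_right_mono[OF this, of A] A
    show "(case st of (x, z, gbar) \<Rightarrow> P x - P xs + 1 / (2 * \<eta>) / A * (norm (z - u))\<^sup>2)
        \<le> potential m st / A - P xs"
      by (simp add: eq add_divide_distrib)
  qed
  also have "\<dots> = measure_pmf.expectation (iterates m) (potential m) / A - P xs"
    by (simp add: integrable_measure_pmf_finite finite_set_iterates)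
  also have "\<dots> \<le> (A * bound + 1 / (2 * \<eta>) * (norm (yt - u))\<^sup>2) / A - P xs"
    using expected_potential_iterates[of m] A
    by (intro diff_right_mono divide_right_mono) (auto simp: A_def)
  also have "\<dots> = (1 - \<alpha> * (1 - 1 / \<gamma>)) * (P xt - P xs) + 1 / (2 * \<eta>) / A * (norm (yt - u))\<^sup>2"
    using A by (simp add: bound_def add_divide_distrib)
  finally show ?thesis
    unfolding C one_stage_AccSVRDA_def by (simp add: case_prod_unfold)
qed

end

section \<open>The accelerated outer loop\<close>

context composite_problem
begin

lemma finite_set_one_stage:
  "finite (set_pmf (one_stage_AccSVRDA n f R yt xt \<eta> m b Q))"
proof -
  have "finite (set_pmf (one_stage_iter n f R yt xt \<eta> b Q m))"
    by (induction m) (auto simp: finite_set_samples)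
  then show ?thesis by (simp add: one_stage_AccSVRDA_def)
qed

lemma finite_set_ns_iter: "finite (set_pmf (DASVRDA_ns_iter n f R x0 z0 \<gamma> L m b s))"
  by (induction s) (auto simp: finite_set_one_stage split: prod.splits)

lemma finite_set_ns: "finite (set_pmf (DASVRDA_ns n f R x0 z0 \<gamma> L m b S))"
  by (simp add: DASVRDA_ns_def finite_set_ns_iter)

lemma finite_set_sc: "finite (set_pmf (DASVRDA_sc n f R x0 \<gamma> L m b S T))"
  by (induction T) (auto simp: finite_set_ns)

text \<open>
  The state is \<open>(x\<^sub>s, x\<^bsub>s-1\<^esub>, z\<^sub>s)\<close>.  The vector inside the norm is the outer weight times
  \<open>z\<^sub>s - u\<^sub>s\<close>, where \<open>u\<^sub>s\<close> is the comparison point of the stage that has just ended.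
\<close>

definition outer_potential :: "real \<Rightarrow> real \<Rightarrow> nat \<Rightarrow> 'a \<times> 'a \<times> 'a \<Rightarrow> real" where
  "outer_potential \<gamma> C s = (\<lambda>(x, xprev, z). (\<theta>_outer \<gamma> s)\<^sup>2 * (P x - P xs)
     + C * (norm (\<theta>_outer \<gamma> s *\<^sub>R z - (\<theta>_outer \<gamma> s - 1) *\<^sub>R xprev - xs))\<^sup>2)"

lemma theta_outer_ge_1:
  assumes "3 \<le> \<gamma>" shows "1 \<le> \<theta>_outer \<gamma> (Suc s)"
proof -
  have "2 / 3 \<le> 1 - 1 / \<gamma>" using assms by (simp add: field_simps)
  then have "2 / 3 * (3 / 2) \<le> (1 - 1 / \<gamma>) * ((real (Suc s) + 2) / 2)"
    by (intro mult_mono) auto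
  then show ?thesis by (simp add: \<theta>_outer_def)
qed

lemma theta_outer_recurrence:
  "(\<theta>_outer \<gamma> (Suc s))\<^sup>2 - (1 - 1 / \<gamma>) * \<theta>_outer \<gamma> (Suc s) \<le> (\<theta>_outer \<gamma> s)\<^sup>2"
proof -
  define \<kappa> where "\<kappa> = 1 - 1 / \<gamma>"
  have "(\<theta>_outer \<gamma> s)\<^sup>2 - ((\<theta>_outer \<gamma> (Suc s))\<^sup>2 - \<kappa> * \<theta>_outer \<gamma> (Suc s)) = (\<kappa> / 2)\<^sup>2"
    unfolding \<theta>_outer_def \<kappa>_def[symmetric] by (simp add: power2_eq_square field_simps)
  then show ?thesis using zero_le_power2[of "\<kappa> / 2"] unfolding \<kappa>_def by linarith
qed

text \<open>
  Apply the bound for one stage with \<open>\<alpha> = 1 / \<theta>'\<close> and multiply by \<open>\<theta>'\<^sup>2\<close>.  The starting point \<open>y\<close> is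
  chosen so that \<open>\<theta>' (y - u)\<close> is exactly the vector in the potential of the previous state.
\<close>

lemma outer_step:
  fixes x xprev z :: 'a and s :: nat
  assumes m: "1 \<le> m" and b: "1 \<le> b" and \<gamma>: "3 \<le> \<gamma>"
  defines "\<eta> \<equiv> step_size \<gamma> m b Lb"
  defines "C \<equiv> 2 / (\<eta> * (real m + 1) * real m)"
  defines "y \<equiv> x + ((\<theta>_outer \<gamma> s - 1) / \<theta>_outer \<gamma> (Suc s)) *\<^sub>R (x - xprev)
               + (\<theta>_outer \<gamma> s / \<theta>_outer \<gamma> (Suc s)) *\<^sub>R (z - x)"
  shows "measure_pmf.expectation (one_stage_AccSVRDA n f R y x \<eta> m b Q)
      (\<lambda>(x', z'). outer_potential \<gamma> C (Suc s) (x', x, z'))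
    \<le> outer_potential \<gamma> C s (x, xprev, z)"
proof -
  define \<theta>' where "\<theta>' = \<theta>_outer \<gamma> (Suc s)"
  define \<theta>\<^sub>0 where "\<theta>\<^sub>0 = \<theta>_outer \<gamma> s"
  have \<theta>': "1 \<le> \<theta>'" unfolding \<theta>'_def using \<gamma> by (rule theta_outer_ge_1)
  interpret inner_stage n f R L xs y x \<gamma> \<eta> "1 / \<theta>'" m b
    using m b \<gamma> \<theta>' by unfold_locales (auto simp: \<eta>_def)
  have scaled: "\<theta>'\<^sup>2 * (norm v)\<^sup>2 = (norm (\<theta>' *\<^sub>R v))\<^sup>2" for v :: 'a
    by (simp add: power_mult_distrib)
  have u: "\<theta>' *\<^sub>R (w - u) = \<theta>' *\<^sub>R w - (\<theta>' - 1) *\<^sub>R x - xs" for w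
    using \<theta>' by (simp add: u_def algebra_simps)
  have y: "\<theta>' *\<^sub>R y - (\<theta>' - 1) *\<^sub>R x - xs = \<theta>\<^sub>0 *\<^sub>R z - (\<theta>\<^sub>0 - 1) *\<^sub>R xprev - xs"
  proof -
    have "\<theta>' *\<^sub>R y = \<theta>' *\<^sub>R x + (\<theta>\<^sub>0 - 1) *\<^sub>R (x - xprev) + \<theta>\<^sub>0 *\<^sub>R (z - x)"
      using \<theta>' unfolding y_def \<theta>'_def[symmetric] \<theta>\<^sub>0_def[symmetric] by (simp add: scaleR_add_right)
    then show ?thesis by (simp add: algebra_simps)
  qed
  have "measure_pmf.expectation (one_stage_AccSVRDA n f R y x \<eta> m b Q)
      (\<lambda>(x', z'). outer_potential \<gamma> C (Suc s) (x', x, z'))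
    = measure_pmf.expectation (one_stage_AccSVRDA n f R y x \<eta> m b Q)
      (\<lambda>p. \<theta>'\<^sup>2 * (case p of (x', z') \<Rightarrow> P x' - P xs + C * (norm (z' - u))\<^sup>2))"
  proof (intro Bochner_Integration.integral_cong refl)
    fix p :: "'a \<times> 'a"
    have "(norm (\<theta>' *\<^sub>R z' - (\<theta>' - 1) *\<^sub>R x - xs))\<^sup>2 = \<theta>'\<^sup>2 * (norm (z' - u))\<^sup>2" for z'
      unfolding u[symmetric] scaled ..
    then show "(case p of (x', z') \<Rightarrow> outer_potential \<gamma> C (Suc s) (x', x, z'))
        = \<theta>'\<^sup>2 * (case p of (x', z') \<Rightarrow> P x' - P xs + C * (norm (z' - u))\<^sup>2)"
      unfolding outer_potential_def \<theta>'_def[symmetric]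
      by (cases p) (simp add: distrib_left mult.left_commute)
  qed
  also have "\<dots> = \<theta>'\<^sup>2 * measure_pmf.expectation (one_stage_AccSVRDA n f R y x \<eta> m b Q)
      (\<lambda>(x', z'). P x' - P xs + C * (norm (z' - u))\<^sup>2)"
    by simp
  also have "\<dots> \<le> \<theta>'\<^sup>2 * ((1 - 1 / \<theta>' * (1 - 1 / \<gamma>)) * (P x - P xs) + C * (norm (y - u))\<^sup>2)"
    using inner_stage_bound unfolding C_def by (intro mult_left_mono) auto
  also have "\<dots> = (\<theta>'\<^sup>2 - (1 - 1 / \<gamma>) * \<theta>') * (P x - P xs) + C * (norm (\<theta>' *\<^sub>R (y - u)))\<^sup>2"
  proof -
    have "\<theta>'\<^sup>2 * (1 - 1 / \<theta>' * (1 - 1 / \<gamma>)) = \<theta>'\<^sup>2 - (1 - 1 / \<gamma>) * \<theta>'"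
      using \<theta>' by (simp add: power2_eq_square algebra_simps)
    then show ?thesis
      unfolding scaled[symmetric] distrib_left by (simp flip: mult.assoc)
  qed
  also have "\<dots> \<le> \<theta>\<^sub>0\<^sup>2 * (P x - P xs) + C * (norm (\<theta>\<^sub>0 *\<^sub>R z - (\<theta>\<^sub>0 - 1) *\<^sub>R xprev - xs))\<^sup>2"
    unfolding u y
    using P_minimal[of x] theta_outer_recurrence[of \<gamma> s]
    by (intro add_right_mono mult_right_mono) (auto simp: \<theta>'_def \<theta>\<^sub>0_def)
  finally show ?thesis by (simp add: outer_potential_def \<theta>\<^sub>0_def)
qed

lemma expected_outer_potential:
  assumes "1 \<le> m" "1 \<le> b" "3 \<le> \<gamma>"
  defines "C \<equiv> 2 / (step_size \<gamma> m b Lb * (real m + 1) * real m)"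
  shows "measure_pmf.expectation (DASVRDA_ns_iter n f R x0 z0 \<gamma> L m b s) (outer_potential \<gamma> C s)
    \<le> (1 - 1 / \<gamma>)\<^sup>2 * (P x0 - P xs) + C * (norm (z0 - xs))\<^sup>2"
proof (induction s)
  case 0
  show ?case by (simp add: outer_potential_def \<theta>_outer_def algebra_simps)
next
  case (Suc s)
  let ?y = "\<lambda>x xprev z. x + ((\<theta>_outer \<gamma> s - 1) / \<theta>_outer \<gamma> (Suc s)) *\<^sub>R (x - xprev)
               + (\<theta>_outer \<gamma> s / \<theta>_outer \<gamma> (Suc s)) *\<^sub>R (z - x)"
  have "measure_pmf.expectation (DASVRDA_ns_iter n f R x0 z0 \<gamma> L m b (Suc s))
        (outer_potential \<gamma> C (Suc s))
      = measure_pmf.expectation (DASVRDA_ns_iter n f R x0 z0 \<gamma> L m b s)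
        (\<lambda>(x, xprev, z). measure_pmf.expectation
          (one_stage_AccSVRDA n f R (?y x xprev z) x (step_size \<gamma> m b Lb) m b Q)
          (\<lambda>(x', z'). outer_potential \<gamma> C (Suc s) (x', x, z')))"
    by (simp add: expectation_bind_finite finite_set_ns_iter finite_set_one_stage case_prod_unfold
        Let_def del: split_paired_Ex split_paired_All)
  also have "\<dots> \<le> measure_pmf.expectation (DASVRDA_ns_iter n f R x0 z0 \<gamma> L m b s)
        (outer_potential \<gamma> C s)"
    using outer_step[OF assms(1-3)]
    by (intro expectation_mono_finite finite_set_ns_iter) (auto simp: C_def)
  finally show ?case using Suc by simp
qed

text \<open>
  Since \<open>z0 = x0\<close>, the initial potential involves only \<open>P x0 - P xs\<close> and the distance to \<open>xs\<close>, and
  the growth condition bounds the latter by the former.  Dividing by the square of the final outer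
  weight gives the contraction factor.
\<close>

lemma expectation_ns_le:
  assumes "1 \<le> m" "1 \<le> b" "3 \<le> \<gamma>"
    and \<mu>: "0 < \<mu>" and growth: "\<mu> / 2 * (norm (x0 - xs))\<^sup>2 \<le> P x0 - P xs"
  defines "\<eta> \<equiv> step_size \<gamma> m b Lb"
  shows "measure_pmf.expectation (DASVRDA_ns n f R x0 x0 \<gamma> L m b S) (\<lambda>x. P x - P xs)
    \<le> 4 * ((1 - 1 / \<gamma>)\<^sup>2 + 4 / (\<eta> * (real m + 1) * real m * \<mu>))
        / ((1 - 1 / \<gamma>)\<^sup>2 * (real S + 2)\<^sup>2) * (P x0 - P xs)"
proof -
  define \<kappa> where "\<kappa> = 1 - 1 / \<gamma>"
  define C where "C = 2 / (\<eta> * (real m + 1) * real m)"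
  define \<theta>\<^sub>S where "\<theta>\<^sub>S = \<theta>_outer \<gamma> S"
  have "0 < \<eta>"
    using Lb_pos assms(2,3)
    by (auto simp: \<eta>_def step_size_def intro!: mult_pos_pos add_pos_nonneg)
  then have C: "0 \<le> C" by (simp add: C_def)
  have "0 < \<kappa>" using assms(3) by (simp add: \<kappa>_def)
  then have \<theta>\<^sub>S: "0 < \<theta>\<^sub>S" by (simp add: \<theta>\<^sub>S_def \<theta>_outer_def \<kappa>_def)
  let ?E = "measure_pmf.expectation (DASVRDA_ns n f R x0 x0 \<gamma> L m b S) (\<lambda>x. P x - P xs)"
  have "\<theta>\<^sub>S\<^sup>2 * ?E = measure_pmf.expectation (DASVRDA_ns_iter n f R x0 x0 \<gamma> L m b S)
      (\<lambda>(x, xprev, z). \<theta>\<^sub>S\<^sup>2 * (P x - P xs))"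
    by (simp add: DASVRDA_ns_def case_prod_unfold)
  also have "\<dots> \<le> measure_pmf.expectation (DASVRDA_ns_iter n f R x0 x0 \<gamma> L m b S)
      (outer_potential \<gamma> C S)"
    using C
    by (intro expectation_mono_finite finite_set_ns_iter) (auto simp: outer_potential_def \<theta>\<^sub>S_def)
  also have "\<dots> \<le> \<kappa>\<^sup>2 * (P x0 - P xs) + C * (norm (x0 - xs))\<^sup>2"
    unfolding C_def \<kappa>_def \<eta>_def using assms(1-3) by (rule expected_outer_potential)
  also have "C * (norm (x0 - xs))\<^sup>2 \<le> C * (2 / \<mu> * (P x0 - P xs))"
    using growth \<mu> C by (intro mult_left_mono) (auto simp: field_simps)
  also have "\<kappa>\<^sup>2 * (P x0 - P xs) + C * (2 / \<mu> * (P x0 - P xs))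
      = (\<kappa>\<^sup>2 + 4 / (\<eta> * (real m + 1) * real m * \<mu>)) * (P x0 - P xs)"
    by (simp add: C_def distrib_right)
  finally have "?E \<le> (\<kappa>\<^sup>2 + 4 / (\<eta> * (real m + 1) * real m * \<mu>)) * (P x0 - P xs) / \<theta>\<^sub>S\<^sup>2"
    using \<theta>\<^sub>S by (simp add: field_simps)
  also have "\<dots> = 4 * (\<kappa>\<^sup>2 + 4 / (\<eta> * (real m + 1) * real m * \<mu>)) / (\<kappa>\<^sup>2 * (real S + 2)\<^sup>2) * (P x0 - P xs)"
    by (simp add: \<theta>\<^sub>S_def \<theta>_outer_def \<kappa>_def power_mult_distrib power_divide)
  finally show ?thesis by (simp add: \<kappa>_def)
qed

end

section \<open>Linear convergence by restarting\<close>

theorem theorem5p4: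
  fixes f :: "nat \<Rightarrow> real ^ 'd \<Rightarrow> real"
    and R :: "real ^ 'd \<Rightarrow> real"
    and L :: "nat \<Rightarrow> real"
    and x0 xstar :: "real ^ 'd"
    and \<mu> \<gamma> \<eta> \<rho> :: real
    and n m b S T :: nat
  assumes "n \<ge> 1"
    and "\<And>i. i \<in> {1..n} \<Longrightarrow> L i > 0"
    and "\<And>i. i \<in> {1..n} \<Longrightarrow> convex_on UNIV (f i)"
    and "\<And>i. i \<in> {1..n} \<Longrightarrow> smooth_with (L i) (f i)"
    and "convex_on UNIV R"
    and "is_minimizer (objective n f R) xstar"
    and "\<mu> > 0"
    and "optimally_strongly_convex \<mu> (objective n f R)"
    and "m \<ge> 1" and "S \<ge> 1" and "b \<in> {1..n}"
    and "\<gamma> = 1 / 2 * (3 + sqrt (9 + 8 * real b / (real m + 1)))"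
    and "\<eta> = 1 / ((1 + \<gamma> * (real m + 1) / real b) * L_bar n L)"
    and "\<rho> = 4 * ((1 - 1 / \<gamma>)\<^sup>2 + 4 / (\<eta> * (real m + 1) * real m * \<mu>))
               / ((1 - 1 / \<gamma>)\<^sup>2 * (real S + 2)\<^sup>2)"
    and "\<rho> \<in> {0<..<1}"
  shows "measure_pmf.expectation (DASVRDA_sc n f R x0 \<gamma> L m b S T)
           (\<lambda>x. objective n f R x - objective n f R xstar)
         \<le> \<rho> ^ T * (objective n f R x0 - objective n f R xstar)"
proof -
  interpret composite_problem n f R L xstar
    using assms(1-6) by unfold_locales
  have "3 \<le> sqrt (9 + 8 * real b / (real m + 1))"
    by (rule real_le_rsqrt) simp
  then have \<gamma>: "3 \<le> \<gamma>" unfolding assms(12) by simp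
  have \<eta>: "\<eta> = step_size \<gamma> m b Lb" by (simp add: assms(13) step_size_def)
  have stage: "measure_pmf.expectation (DASVRDA_ns n f R x x \<gamma> L m b S) (\<lambda>x. P x - P xstar)
      \<le> \<rho> * (P x - P xstar)" for x
    unfolding assms(14) \<eta> using assms(6-9,11) \<gamma>
    by (intro expectation_ns_le) (auto simp: optimally_strongly_convex_def)
  show ?thesis
  proof (induction T)
    case (Suc T)
    have "measure_pmf.expectation (DASVRDA_sc n f R x0 \<gamma> L m b S (Suc T)) (\<lambda>x. P x - P xstar)
        = measure_pmf.expectation (DASVRDA_sc n f R x0 \<gamma> L m b S T)
            (\<lambda>x. measure_pmf.expectation (DASVRDA_ns n f R x x \<gamma> L m b S) (\<lambda>x. P x - P xstar))"
      by (simp add: expectation_bind_finite finite_set_sc finite_set_ns)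
    also have "\<dots> \<le> measure_pmf.expectation (DASVRDA_sc n f R x0 \<gamma> L m b S T)
            (\<lambda>x. \<rho> * (P x - P xstar))"
      by (intro expectation_mono_finite finite_set_sc stage)
    also have "\<dots> = \<rho> * measure_pmf.expectation (DASVRDA_sc n f R x0 \<gamma> L m b S T)
            (\<lambda>x. P x - P xstar)"
      by simp
    also have "\<dots> \<le> \<rho> * (\<rho> ^ T * (P x0 - P xstar))"
      using assms(15) Suc by (intro mult_left_mono) auto
    finally show ?case by simp
  qed simp
qed

end
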